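(* Let $H=(\mathbb{R}^n,E)$ be an algebraic $k$-hypergraph. Then there is a countable collection $\mathcal{A}$ of sets with $\mathbb{R}^n=\bigcup\mathcal{A}$ such that for each $A\in\mathcal{A}$, the induced subhypergraph $H[A]$ is isomorphic to an algebraic multi-template $k$-hypergraph $L(\mathbb{R}^d,\mathcal{P})$ for some $d<\omega$ and some set $\mathcal{P}$ of $d$-dimensional $k$-templates.
   Context: For $2\le k<\omega$, a $k$-hypergraph is a pair $H=(V,E)$ with $E\subseteq[V]^k$ (the $k$-element subsets of $V$). For $A\subseteq V$, the induced subhypergraph is $H[A]=(A,E\cap[A]^k)$. Two $k$-hypergraphs are isomorphic if there is a bijection between their vertex sets mapping edges exactly onto edges. A $k$-hypergraph is algebraic if there are $n<\omega$ and a real polynomial $p(x_0,\dots,x_{k-1})$ (each $x_i$ an $n$-tuple of variables) such that $V=\mathbb{R}^n$ and $E$ is the set of $\{a_0,\dots,a_{k-1}\}\in[\mathbb{R}^n]^k$ (for some enumeration of its elements) with $p(a_0,\dots,a_{k-1})=0$. A $d$-dimensional $k$-template is a set $P$ of $d$-tuples with $|P|=k$. For $d$-dimensional $k$-templates $P,Q$, a homomorphism $f:P\to Q$ is a one-to-one map such that whenever $x,y\in P$, $i<d$ and $x_i=y_i$, then $f(x)_i=f(y)_i$; $Q$ is a homomorphic image of $P$ if such an $f$ exists. For sets $X_0,\dots,X_{d-1}$, $X=X_0\times\cdots\times X_{d-1}$, and a set $\mathcal{P}$ of $d$-dimensional $k$-templates (possibly empty), the multi-template hypergraph $L(X,\mathcal{P})$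 is the $k$-hypergraph $(X,F)$ where $F$ is the set of $Q\in[X]^k$ that are homomorphic images of some $P\in\mathcal{P}$. *)

theory Defs
  imports Complex_Main "HOL-Library.Countable_Set"
begin

definition Rn :: "nat \<Rightarrow> real list set" where
  "Rn n = {x. length x = n}"

inductive poly_fun :: "nat \<Rightarrow> ((nat \<Rightarrow> real) \<Rightarrow> real) \<Rightarrow> bool" for N :: nat where
  pf_const: "poly_fun N (\<lambda>x. c)"
| pf_var: "i < N \<Longrightarrow> poly_fun N (\<lambda>x. x i)"
| pf_add: "poly_fun N p \<Longrightarrow> poly_fun N q \<Longrightarrow> poly_fun N (\<lambda>x. p x + q x)"
| pf_mult: "poly_fun N p \<Longrightarrow> poly_fun N q \<Longrightarrow> poly_fun N (\<lambda>x. p x * q x)"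

definition ksubsets :: "nat \<Rightarrow> 'a set \<Rightarrow> 'a set set" where
  "ksubsets k V = {e. e \<subseteq> V \<and> finite e \<and> card e = k}"

definition k_hypergraph :: "nat \<Rightarrow> 'a set \<times> 'a set set \<Rightarrow> bool" where
  "k_hypergraph k H \<longleftrightarrow> 2 \<le> k \<and> snd H \<subseteq> ksubsets k (fst H)"

definition induced :: "nat \<Rightarrow> 'a set \<times> 'a set set \<Rightarrow> 'a set \<Rightarrow> 'a set \<times> 'a set set" where
  "induced k H A = (A, snd H \<inter> ksubsets k A)"

definition hg_iso :: "'a set \<times> 'a set set \<Rightarrow> 'b set \<times> 'b set set \<Rightarrow> bool" where
  "hg_iso H H' \<longleftrightarrow> (\<exists>f. bij_betw f (fst H) (fst H') \<and>
       (\<forall>e. e \<subseteq> fst H \<longrightarrow> (e \<in> snd H \<longleftrightarrow> f ` e \<in> snd H')))"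

text \<open>Algebraic k-hypergraph: V = R^n and E is the set of k-sets {a_0,...,a_(k-1)}
  (for some enumeration) with p(a_0,...,a_(k-1)) = 0; variable number i*n+j
  of p is coordinate j of a_i.\<close>
definition algebraic_edges :: "nat \<Rightarrow> nat \<Rightarrow> ((nat \<Rightarrow> real) \<Rightarrow> real) \<Rightarrow> real list set set" where
  "algebraic_edges k n p =
     {e. e \<in> ksubsets k (Rn n) \<and>
         (\<exists>a :: nat \<Rightarrow> real list. bij_betw a {..<k} e \<and>
              p (\<lambda>v. a (v div n) ! (v mod n)) = 0)}"

definition algebraic_hg :: "nat \<Rightarrow> real list set \<times> real list set set \<Rightarrow> bool" where
  "algebraic_hg k H \<longleftrightarrow> 2 \<le> k \<and>
     (\<exists>n p. poly_fun (k * n) p \<and> fst H = Rn n \<and> snd H = algebraic_edges k n p)"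

definition template :: "nat \<Rightarrow> nat \<Rightarrow> real list set \<Rightarrow> bool" where
  "template d k P \<longleftrightarrow> P \<subseteq> Rn d \<and> finite P \<and> card P = k"

definition template_hom :: "nat \<Rightarrow> real list set \<Rightarrow> real list set \<Rightarrow> (real list \<Rightarrow> real list) \<Rightarrow> bool" where
  "template_hom d P Q f \<longleftrightarrow> f ` P \<subseteq> Q \<and> inj_on f P \<and>
     (\<forall>x\<in>P. \<forall>y\<in>P. \<forall>i<d. x ! i = y ! i \<longrightarrow> f x ! i = f y ! i)"

definition hom_image :: "nat \<Rightarrow> real list set \<Rightarrow> real list set \<Rightarrow> bool" where
  "hom_image d P Q \<longleftrightarrow> (\<exists>f. template_hom d P Q f)"

definition multi_template :: "nat \<Rightarrow> nat \<Rightarrow> real list set \<Rightarrow> real list set set \<Rightarrow> real list set \<times> real list set set" where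
  "multi_template d k X PP = (X, {Q \<in> ksubsets k X. \<exists>P\<in>PP. hom_image d P Q})"

end

(*
  Fix a countable family of terms that denote holomorphic functions of finitely many
  complex variables; it contains the coefficients of p and the rationals and is closed under ring
  operations, differentiation, integration over rational circles, substitution of rationals,
  renaming of variables and complex conjugation. Call a set T of reals independent if a term that
  vanishes at a tuple of distinct elements of T vanishes at all real points of its polydisc.
  If T is maximal independent, then every real x is the value of a term at a tuple from T: x is a
  zero of finite order of a nonzero holomorphic function with parameters in T; differentiating
  makes the zero simple, and a simple zero is a quotient of two contour integrals.
  Shifting the elements of T by rationals makes T meet every interval in continuum many points.

  A point a of R^n is then F(t) for a tuple t from T of minimal length d. On the product of the sets
  T Int D_i, for disjoint rational intervals D_i around the t_i, the map F is injective by
  minimality, and there are only countably many choices of F and the D_i. By independence the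
  relation p(F(x_0), ..., F(x_(k-1))) = 0 depends only on which coordinates of the x_j coincide
  and survives further coincidences. So the edges pull back to a family of k-sets closed
  under template homomorphisms, which is cut out by a product, over its coincidence patterns, of
  sums of squares of differences.
*)
theory Submission
  imports Defs "HOL-Complex_Analysis.Complex_Analysis"
begin

section \<open>Separately holomorphic functions\<close>

lemma continuous_on_circle_integral:
  fixes F :: "'a::topological_space \<Rightarrow> complex \<Rightarrow> complex"
  assumes F: "continuous_on (U \<times> sphere a \<rho>) (\<lambda>(z, w). F z w)" and \<rho>: "0 \<le> \<rho>"
  shows "continuous_on U (\<lambda>z. contour_integral (circlepath a \<rho>) (F z))"
proof -
  have "continuous_on (U \<times> cbox 0 (1::real)) (\<lambda>p. (\<lambda>(z, w). F z w) (fst p, circlepath a \<rho> (snd p)))"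
  proof (rule continuous_on_compose2 [OF F])
    show "continuous_on (U \<times> cbox 0 1) (\<lambda>p. (fst p, circlepath a \<rho> (snd p)))"
      unfolding circlepath by (intro continuous_intros)
    show "(\<lambda>p. (fst p, circlepath a \<rho> (snd p))) ` (U \<times> cbox 0 1) \<subseteq> U \<times> sphere a \<rho>"
      using \<rho> path_image_circlepath[of a \<rho>] by (auto simp: path_image_def)
  qed
  then have "continuous_on (U \<times> cbox 0 (1::real)) (\<lambda>(z, t). F z (circlepath a \<rho> t) *
      (2 * of_real pi * \<i> * of_real \<rho> * exp (2 * of_real pi * \<i> * of_real t)))"
    by (auto simp: case_prod_unfold intro!: continuous_intros)
  from integral_continuous_on_param[OF this] show ?thesis
    by (simp add: contour_integral_integral vector_derivative_circlepath)
qed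

text \<open>Morera's theorem: the integral over a triangle in the parameter may be exchanged with
  the circle integral, and then the inner triangle integral is 0 by Cauchy's theorem for each fixed
  \<open>w\<close>.\<close>

lemma holomorphic_on_circle_integral:
  fixes F :: "complex \<Rightarrow> complex \<Rightarrow> complex"
  assumes F: "continuous_on (ball b s \<times> sphere a \<rho>) (\<lambda>(z, w). F z w)" and \<rho>: "0 < \<rho>"
    and h: "\<And>w. w \<in> sphere a \<rho> \<Longrightarrow> (\<lambda>z. F z w) holomorphic_on ball b s"
  shows "(\<lambda>z. contour_integral (circlepath a \<rho>) (F z)) holomorphic_on ball b s"
proof -
  let ?G = "\<lambda>z. contour_integral (circlepath a \<rho>) (F z)"
  have contG: "continuous_on (ball b s) ?G"
    using continuous_on_circle_integral[OF F] \<rho> by simp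
  have swap: "contour_integral (linepath x y) ?G =
      contour_integral (circlepath a \<rho>) (\<lambda>w. contour_integral (linepath x y) (\<lambda>z. F z w))"
    if "closed_segment x y \<subseteq> ball b s" for x y
  proof (rule contour_integral_swap)
    show "continuous_on (path_image (linepath x y) \<times> path_image (circlepath a \<rho>)) (\<lambda>(y1, y2). F y1 y2)"
      using \<rho> that by (intro continuous_on_subset[OF F]) auto
    show "continuous_on {0..1} (\<lambda>t. vector_derivative (circlepath a \<rho>) (at t))"
      by (auto simp: vector_derivative_circlepath intro!: continuous_intros)
  qed auto
  have contl: "continuous_on (sphere a \<rho>) (\<lambda>w. contour_integral (linepath x y) (\<lambda>z. F z w))"
    if "closed_segment x y \<subseteq> ball b s" for x y
  proof -
    have "continuous_on (sphere a \<rho> \<times> cbox 0 (1::real)) (\<lambda>p. (\<lambda>(z, w). F z w) (linepath x y (snd p), fst p))"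
    proof (rule continuous_on_compose2 [OF F])
      show "continuous_on (sphere a \<rho> \<times> cbox 0 1) (\<lambda>p. (linepath x y (snd p), fst p))"
        unfolding linepath_def by (intro continuous_intros)
      have "linepath x y t \<in> ball b s" if "0 \<le> t" "t \<le> 1" for t
        using that \<open>closed_segment x y \<subseteq> ball b s\<close> path_image_linepath[of x y] unfolding path_image_def by fastforce
      then show "(\<lambda>p. (linepath x y (snd p), fst p)) ` (sphere a \<rho> \<times> cbox 0 1) \<subseteq> ball b s \<times> sphere a \<rho>"
        by auto
    qed
    then have "continuous_on (sphere a \<rho> \<times> cbox 0 (1::real)) (\<lambda>(w, t). F (linepath x y t) w * (y - x))"
      by (auto simp: case_prod_unfold intro!: continuous_intros)
    from integral_continuous_on_param[OF this] show ?thesis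
      by (simp add: contour_integral_integral)
  qed
  have int: "(\<lambda>w. contour_integral (linepath x y) (\<lambda>z. F z w)) contour_integrable_on circlepath a \<rho>"
    if "closed_segment x y \<subseteq> ball b s" for x y
    by (rule contour_integrable_continuous_circlepath) (use contl[OF that] \<rho> in auto)
  have "?G analytic_on ball b s"
  proof (rule Morera_triangle[OF contG open_ball], safe)
    fix x y z assume sub: "convex hull {x, y, z} \<subseteq> ball b s"
    have seg: "closed_segment x y \<subseteq> ball b s" "closed_segment y z \<subseteq> ball b s" "closed_segment z x \<subseteq> ball b s"
      by (rule subset_trans[OF closed_segment_subset_convex_hull sub]; simp add: hull_inc)+
    have z: "contour_integral (linepath x y) (\<lambda>u. F u w) + contour_integral (linepath y z) (\<lambda>u. F u w)
        + contour_integral (linepath z x) (\<lambda>u. F u w) = 0" if "w \<in> sphere a \<rho>" for w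
    proof -
      have hw: "(\<lambda>u. F u w) holomorphic_on ball b s" using h that .
      have c: "(\<lambda>u. F u w) contour_integrable_on linepath p q" if "closed_segment p q \<subseteq> ball b s" for p q
        using that holomorphic_on_imp_continuous_on[OF hw]
        by (intro contour_integrable_continuous_linepath) (auto intro: continuous_on_subset)
      have "((\<lambda>u. F u w) has_contour_integral 0) (linepath x y +++ linepath y z +++ linepath z x)"
        by (rule Cauchy_theorem_triangle) (rule holomorphic_on_subset[OF hw sub])
      then have "contour_integral (linepath x y +++ linepath y z +++ linepath z x) (\<lambda>u. F u w) = 0"
        by (rule contour_integral_unique)
      then show ?thesis by (simp add: c seg add.assoc)
    qed
    have "contour_integral (linepath x y) ?G + contour_integral (linepath y z) ?G + contour_integral (linepath z x) ?G
      = contour_integral (circlepath a \<rho>) (\<lambda>w. contour_integral (linepath x y) (\<lambda>u. F u w)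
         + contour_integral (linepath y z) (\<lambda>u. F u w) + contour_integral (linepath z x) (\<lambda>u. F u w))"
      by (simp add: swap seg int contour_integral_add contour_integrable_add)
    also have "\<dots> = contour_integral (circlepath a \<rho>) (\<lambda>w. 0)"
      by (rule contour_integral_eq) (use z \<rho> in auto)
    finally show "contour_integral (linepath x y) ?G + contour_integral (linepath y z) ?G + contour_integral (linepath z x) ?G = 0"
      by simp
  qed
  then show ?thesis by (rule analytic_imp_holomorphic)
qed

text \<open>Variables are indexed by natural numbers, and a polydisc restricts only those in a finite
  set \<open>I\<close>. Its centre is real, so that conjugation preserves it.\<close>

definition polydisc :: "nat set \<Rightarrow> (nat \<Rightarrow> real) \<Rightarrow> (nat \<Rightarrow> real) \<Rightarrow> (nat \<Rightarrow> complex) set" where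
  "polydisc I c r = {z. \<forall>i\<in>I. z i \<in> ball (complex_of_real (c i)) (r i)}"

definition depends_on :: "nat set \<Rightarrow> ((nat \<Rightarrow> complex) \<Rightarrow> complex) \<Rightarrow> bool" where
  "depends_on I f \<longleftrightarrow> (\<forall>z z'. (\<forall>i\<in>I. z i = z' i) \<longrightarrow> f z = f z')"

text \<open>By Osgood's lemma, joint continuity with holomorphy in each variable separately amounts
  to holomorphy in several variables; in this form every argument stays one-dimensional. Points are
  infinite sequences and terms are total functions, so dependence on the coordinates in
  \<open>I\<close> alone is demanded everywhere, also outside the polydisc.\<close>

definition hol :: "nat set \<Rightarrow> (nat \<Rightarrow> real) \<Rightarrow> (nat \<Rightarrow> real) \<Rightarrow> ((nat \<Rightarrow> complex) \<Rightarrow> complex) \<Rightarrow> bool" where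
  "hol I c r f \<longleftrightarrow> depends_on I f \<and> continuous_on (polydisc I c r) f \<and>
     (\<forall>z\<in>polydisc I c r. \<forall>i\<in>I. (\<lambda>w. f (z(i := w))) holomorphic_on ball (complex_of_real (c i)) (r i))"

lemma depends_onD: "depends_on I f \<Longrightarrow> (\<And>i. i \<in> I \<Longrightarrow> z i = z' i) \<Longrightarrow> f z = f z'"
  unfolding depends_on_def by blast

lemma polydisc_upd: "z \<in> polydisc I c r \<Longrightarrow> w \<in> ball (complex_of_real (c i)) (r i) \<Longrightarrow> z(i := w) \<in> polydisc I c r"
  by (auto simp: polydisc_def)

lemma open_polydisc: assumes "finite I" shows "open (polydisc I c r)"
proof -
  have "polydisc I c r = (\<Inter>i\<in>I. (\<lambda>z. z i) -` ball (complex_of_real (c i)) (r i))"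
    by (auto simp: polydisc_def)
  moreover have "open ((\<lambda>z::nat \<Rightarrow> complex. z i) -` ball (complex_of_real (c i)) (r i))" for i
    by (rule open_vimage[OF open_ball]) simp
  ultimately show ?thesis using assms by (auto intro!: open_INT)
qed

lemma continuous_on_fun_upd_pair:
  "continuous_on S (\<lambda>p. (fst p)(j := snd p) :: nat \<Rightarrow> complex)"
proof (rule continuous_on_coordinatewise_then_product)
  fix i show "continuous_on S (\<lambda>p. ((fst p)(j := snd p :: complex)) i)"
    by (cases "i = j") (auto intro: continuous_on_product_then_coordinatewise[OF continuous_on_fst[OF continuous_on_id]] intro!: continuous_on_snd continuous_on_id)
qed

section \<open>Closure properties of separately holomorphic functions\<close>

lemma hol_const: "hol I c r (\<lambda>_. k)"
  by (simp add: hol_def depends_on_def)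

lemma hol_var: assumes "i \<in> I" shows "hol I c r (\<lambda>z. z i)"
proof -
  have "(\<lambda>w. (z(m := w)) i) holomorphic_on S" for z :: "nat \<Rightarrow> complex" and m S
    by (cases "i = m") (auto intro!: holomorphic_intros)
  then show ?thesis
    using assms continuous_on_product_then_coordinatewise[OF continuous_on_id]
    by (auto simp: hol_def depends_on_def)
qed

lemma hol_add:
  assumes "hol I c r f" "hol I c r g"
  shows "hol I c r (\<lambda>z. f z + g z)"
proof -
  have "depends_on I (\<lambda>z. f z + g z)" using assms unfolding hol_def depends_on_def by metis
  then show ?thesis using assms unfolding hol_def by (simp add: continuous_on_add holomorphic_on_add)
qed

lemma hol_mult:
  assumes "hol I c r f" "hol I c r g"
  shows "hol I c r (\<lambda>z. f z * g z)"
proof -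
  have "depends_on I (\<lambda>z. f z * g z)" using assms unfolding hol_def depends_on_def by metis
  then show ?thesis using assms unfolding hol_def by (simp add: continuous_on_mult holomorphic_on_mult)
qed

lemma hol_inverse:
  assumes "hol I c r f" "\<And>z. z \<in> polydisc I c r \<Longrightarrow> f z \<noteq> 0"
  shows "hol I c r (\<lambda>z. inverse (f z))"
proof -
  have "depends_on I (\<lambda>z. inverse (f z))" using assms unfolding hol_def depends_on_def by metis
  moreover have "(\<lambda>w. inverse (f (z(i := w)))) holomorphic_on ball (complex_of_real (c i)) (r i)"
    if "z \<in> polydisc I c r" "i \<in> I" for z i
    using assms that by (intro holomorphic_on_inverse) (auto simp: hol_def polydisc_upd)
  ultimately show ?thesis using assms unfolding hol_def by (simp add: continuous_on_inverse)
qed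

text \<open>Since \<open>l\<close> is injective on \<open>I\<close>, changing one variable in
  \<open>J\<close> changes at most one argument of \<open>f\<close>, so separate holomorphy of
  \<open>f\<close> suffices. Identifying two variables would amount to restricting \<open>f\<close>
  to a diagonal.\<close>

lemma hol_comp_shift:
  assumes f: "hol I c r f" and l: "inj_on l I" "l ` I \<subseteq> J"
    and sub: "\<And>i w. i \<in> I \<Longrightarrow> w \<in> ball (complex_of_real (c' (l i))) (r' (l i)) \<Longrightarrow> w + of_real (q i) \<in> ball (complex_of_real (c i)) (r i)"
    and \<phi>: "\<And>z i. i \<in> I \<Longrightarrow> \<phi> z i = z (l i) + of_real (q i)"
  shows "hol J c' r' (\<lambda>z. f (\<phi> z))"
proof -
  define \<psi> where "\<psi> z = (\<lambda>i. z (l i) + complex_of_real (q i))" for z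
  have dep: "depends_on I f" using f by (simp add: hol_def)
  have eq: "f (\<phi> z) = f (\<psi> z)" for z
    by (rule depends_onD[OF dep]) (simp add: \<phi> \<psi>_def)
  have mem: "\<psi> z \<in> polydisc I c r" if "z \<in> polydisc J c' r'" for z
    using that l(2) sub by (fastforce simp: polydisc_def \<psi>_def)
  have d: "depends_on J (\<lambda>z. f (\<psi> z))"
    unfolding depends_on_def
  proof (intro allI impI)
    fix z z' :: "nat \<Rightarrow> complex" assume "\<forall>i\<in>J. z i = z' i"
    then show "f (\<psi> z) = f (\<psi> z')"
      using l(2) by (intro depends_onD[OF dep]) (auto simp: \<psi>_def)
  qed
  have ct: "continuous_on (polydisc J c' r') (\<lambda>z. f (\<psi> z))"
  proof (rule continuous_on_compose2[where g = f and f = \<psi> and t = "polydisc I c r"])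
    show "continuous_on (polydisc J c' r') \<psi>"
      unfolding \<psi>_def
      by (intro continuous_on_coordinatewise_then_product continuous_on_add continuous_on_const
          continuous_on_product_then_coordinatewise[OF continuous_on_id])
  qed (use f mem in \<open>auto simp: hol_def\<close>)
  have "(\<lambda>w. f (\<psi> (z(i := w)))) holomorphic_on ball (complex_of_real (c' i)) (r' i)"
    if z: "z \<in> polydisc J c' r'" and i: "i \<in> J" for z i
  proof (cases "i \<in> l ` I")
    case True
    then obtain m where m: "m \<in> I" "i = l m" by blast
    have e: "f (\<psi> (z(i := w))) = f ((\<psi> z)(m := w + of_real (q m)))" for w
      using m inj_onD[OF l(1)] by (intro depends_onD[OF dep]) (auto simp: \<psi>_def)
    have "((\<lambda>w. f ((\<psi> z)(m := w))) \<circ> (\<lambda>w. w + of_real (q m))) holomorphic_on ball (complex_of_real (c' i)) (r' i)"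
    proof (rule holomorphic_on_compose_gen[where t = "ball (complex_of_real (c m)) (r m)"])
      show "(\<lambda>w. f ((\<psi> z)(m := w))) holomorphic_on ball (complex_of_real (c m)) (r m)"
        using f mem[OF z] m by (auto simp: hol_def)
    qed (use m sub in \<open>auto intro!: holomorphic_intros\<close>)
    then show ?thesis by (simp add: e o_def)
  next
    case False
    then have "f (\<psi> (z(i := w))) = f (\<psi> z)" for w
      by (intro depends_onD[OF dep]) (auto simp: \<psi>_def)
    then show ?thesis by simp
  qed
  with d ct show ?thesis by (simp add: hol_def eq)
qed

lemma hol_mono:
  assumes "hol I c r f" "I \<subseteq> J"
    "\<And>i. i \<in> I \<Longrightarrow> ball (complex_of_real (c' i)) (r' i) \<subseteq> ball (complex_of_real (c i)) (r i)"
  shows "hol J c' r' f"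
  using hol_comp_shift[of I c r f "\<lambda>i. i" J c' r' "\<lambda>_. 0" "\<lambda>z. z"] assms by force

lemma hol_subst:
  assumes f: "hol I c r f" and a: "a \<in> ball (complex_of_real (c j)) (r j)"
  shows "hol (I - {j}) c r (\<lambda>z. f (z(j := a)))"
proof -
  have dep: "depends_on I f" using f by (simp add: hol_def)
  have mem: "z(j := a) \<in> polydisc I c r" if "z \<in> polydisc (I - {j}) c r" for z
    using that a by (auto simp: polydisc_def)
  have d: "depends_on (I - {j}) (\<lambda>z. f (z(j := a)))"
    using dep by (auto simp: depends_on_def)
  have ct: "continuous_on (polydisc (I - {j}) c r) (\<lambda>z. f (z(j := a)))"
  proof (rule continuous_on_compose2[where g = f and t = "polydisc I c r"])
    show "continuous_on (polydisc (I - {j}) c r) (\<lambda>z. z(j := a))"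
    proof (rule continuous_on_coordinatewise_then_product)
      fix i show "continuous_on (polydisc (I - {j}) c r) (\<lambda>z. (z(j := a)) i)"
        by (cases "i = j") (auto intro: continuous_on_product_then_coordinatewise[OF continuous_on_id])
    qed
  qed (use f mem in \<open>auto simp: hol_def\<close>)
  have "(\<lambda>w. f (z(i := w, j := a))) holomorphic_on ball (complex_of_real (c i)) (r i)"
    if z: "z \<in> polydisc (I - {j}) c r" and i: "i \<in> I - {j}" for z i
  proof -
    have "z(i := w, j := a) = z(j := a, i := w)" for w using i by auto
    then show ?thesis using f mem[OF z] i by (auto simp: hol_def)
  qed
  with d ct show ?thesis by (simp add: hol_def)
qed

text \<open>Schwarz reflection: conjugating both the arguments and the value restores holomorphy.
  Comparing a function with its reflection is the later test for being real at real points.\<close>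

lemma hol_cnj:
  assumes f: "hol I c r f"
  shows "hol I c r (\<lambda>z. cnj (f (\<lambda>i. cnj (z i))))"
proof -
  have ball: "cnj w \<in> ball (complex_of_real a) s \<longleftrightarrow> w \<in> ball (complex_of_real a) s" for w a s
    by (metis complex_cnj_complex_of_real complex_cnj_diff complex_mod_cnj dist_complex_def mem_ball)
  have dep: "depends_on I f" using f by (simp add: hol_def)
  have mem: "(\<lambda>i. cnj (z i)) \<in> polydisc I c r" if "z \<in> polydisc I c r" for z
    using that by (auto simp: polydisc_def ball simp del: mem_ball)
  have d: "depends_on I (\<lambda>z. cnj (f (\<lambda>i. cnj (z i))))"
    using dep by (auto simp: depends_on_def)
  have ct: "continuous_on (polydisc I c r) (\<lambda>z. cnj (f (\<lambda>i. cnj (z i))))"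
  proof (intro continuous_intros, rule continuous_on_compose2[where g = f and t = "polydisc I c r"])
    show "continuous_on (polydisc I c r) (\<lambda>z i. cnj (z i))"
      by (intro continuous_on_coordinatewise_then_product continuous_on_cnj
          continuous_on_product_then_coordinatewise[OF continuous_on_id])
  qed (use f mem in \<open>auto simp: hol_def\<close>)
  have "(\<lambda>w. cnj (f (\<lambda>m. cnj ((z(i := w)) m)))) holomorphic_on ball (complex_of_real (c i)) (r i)"
    if z: "z \<in> polydisc I c r" and i: "i \<in> I" for z i
  proof -
    have e: "(\<lambda>m. cnj ((z(i := w)) m)) = (\<lambda>m. cnj (z m))(i := cnj w)" for w
      by auto
    have h: "(\<lambda>w. f ((\<lambda>m. cnj (z m))(i := w))) holomorphic_on ball (complex_of_real (c i)) (r i)"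
      using f mem[OF z] i by (auto simp: hol_def)
    have im: "cnj ` ball (complex_of_real (c i)) (r i) = ball (complex_of_real (c i)) (r i)"
      using ball by (metis (no_types, opaque_lifting) complex_cnj_cnj image_eqI subsetI subset_antisym image_subsetI)
    have "cnj \<circ> (\<lambda>w. f ((\<lambda>m. cnj (z m))(i := w))) \<circ> cnj holomorphic_on ball (complex_of_real (c i)) (r i)"
      by (rule holomorphic_on_compose_cnj_cnj) (use h im in auto)
    then show ?thesis unfolding e by (simp add: o_def)
  qed
  with d ct show ?thesis by (simp add: hol_def)
qed

text \<open>Regularity of \<open>f\<close> is demanded only where variable \<open>j\<close> lies on
  the circle, because the integrands of interest have a pole inside it. The bound variable
  \<open>j\<close> is outside \<open>I\<close>, so the polydisc does not restrict it.\<close>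

lemma hol_circle_integral:
  assumes dep: "depends_on (insert j I) f" and j: "j \<notin> I" and \<rho>: "0 < \<rho>"
    and cont: "continuous_on {z \<in> polydisc I c r. z j \<in> sphere a \<rho>} f"
    and h: "\<And>z i. z \<in> polydisc I c r \<Longrightarrow> z j \<in> sphere a \<rho> \<Longrightarrow> i \<in> I \<Longrightarrow>
       (\<lambda>w. f (z(i := w))) holomorphic_on ball (complex_of_real (c i)) (r i)"
  shows "hol I c r (\<lambda>z. contour_integral (circlepath a \<rho>) (\<lambda>w. f (z(j := w))))"
proof -
  let ?F = "\<lambda>z. contour_integral (circlepath a \<rho>) (\<lambda>w. f (z(j := w)))"
  have d: "depends_on I ?F"
    unfolding depends_on_def
  proof (intro allI impI)
    fix z z' :: "nat \<Rightarrow> complex" assume "\<forall>i\<in>I. z i = z' i"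
    then have "f (z(j := w)) = f (z'(j := w))" for w
      by (intro depends_onD[OF dep]) auto
    then show "?F z = ?F z'" by simp
  qed
  have mem: "z(j := w) \<in> polydisc I c r" if "z \<in> polydisc I c r" for z w
    using that j by (auto simp: polydisc_def)
  have "continuous_on (polydisc I c r \<times> sphere a \<rho>) (\<lambda>p. f ((fst p)(j := snd p)))"
    by (rule continuous_on_compose2[OF cont continuous_on_fun_upd_pair]) (auto simp: mem)
  then have ct: "continuous_on (polydisc I c r) ?F"
    using \<rho> by (intro continuous_on_circle_integral) (auto simp: case_prod_unfold)
  have "(\<lambda>y. ?F (z(i := y))) holomorphic_on ball (complex_of_real (c i)) (r i)"
    if z: "z \<in> polydisc I c r" and i: "i \<in> I" for z i
  proof (rule holomorphic_on_circle_integral[OF _ \<rho>])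
    have "continuous_on (ball (complex_of_real (c i)) (r i) \<times> sphere a \<rho>) (\<lambda>p. f ((z(i := fst p))(j := snd p)))"
    proof (rule continuous_on_compose2[OF cont])
      show "continuous_on (ball (complex_of_real (c i)) (r i) \<times> sphere a \<rho>) (\<lambda>p. z(i := fst p, j := snd p))"
      proof (rule continuous_on_coordinatewise_then_product)
        fix m show "continuous_on (ball (complex_of_real (c i)) (r i) \<times> sphere a \<rho>) (\<lambda>p. (z(i := fst p, j := snd p)) m)"
          by (cases "m = j"; cases "m = i") (auto intro!: continuous_intros)
      qed
    qed (use z in \<open>auto simp: mem polydisc_upd\<close>)
    then show "continuous_on (ball (complex_of_real (c i)) (r i) \<times> sphere a \<rho>) (\<lambda>(y, w). f (z(i := y, j := w)))"
      by (simp add: case_prod_unfold)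
    fix w assume w: "w \<in> sphere a \<rho>"
    have "z(i := y, j := w) = z(j := w, i := y)" for y using i j by auto
    then show "(\<lambda>y. f (z(i := y, j := w))) holomorphic_on ball (complex_of_real (c i)) (r i)"
      using h[of "z(j := w)" i] z i w by (simp add: mem)
  qed
  with d ct show ?thesis by (simp add: hol_def)
qed

text \<open>Cauchy's formula turns the derivative into a circle integral whose kernel is continuous
  in all variables. Continuity and holomorphy in the other variables are then inherited from circle
  integrals; in variable \<open>j\<close> itself it is the one-variable fact.\<close>

lemma hol_deriv:
  assumes f: "hol I c r f" and j: "j \<in> I" and I: "finite I"
  shows "hol I c r (\<lambda>z. deriv (\<lambda>w. f (z(j := w))) (z j))"
proof -
  let ?D = "\<lambda>z. deriv (\<lambda>w. f (z(j := w))) (z j)"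
  have dep: "depends_on I f" and ctf: "continuous_on (polydisc I c r) f"
    and hf: "\<And>z i. z \<in> polydisc I c r \<Longrightarrow> i \<in> I \<Longrightarrow> (\<lambda>w. f (z(i := w))) holomorphic_on ball (complex_of_real (c i)) (r i)"
    using f by (auto simp: hol_def)
  have d: "depends_on I ?D"
    unfolding depends_on_def
  proof (intro allI impI)
    fix z z' :: "nat \<Rightarrow> complex" assume "\<forall>i\<in>I. z i = z' i"
    then have "f (z(j := w)) = f (z'(j := w))" for w
      by (intro depends_onD[OF dep]) auto
    then show "?D z = ?D z'" using j \<open>\<forall>i\<in>I. z i = z' i\<close> by simp
  qed
  have cauchy: "?D z = contour_integral (circlepath b \<rho>) (\<lambda>w. f (z(j := w)) / (w - z j)\<^sup>2) / (2 * of_real pi * \<i>)"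
    if z: "z \<in> polydisc I c r" and b: "cball b \<rho> \<subseteq> ball (complex_of_real (c j)) (r j)" and zb: "z j \<in> ball b \<rho>" for z b \<rho>
  proof -
    have h: "(\<lambda>w. f (z(j := w))) holomorphic_on cball b \<rho>"
      using holomorphic_on_subset[OF hf[OF z j] b] .
    have "?D z = 1 / (2 * of_real pi * \<i>) * contour_integral (circlepath b \<rho>) (\<lambda>w. f (z(j := w)) / (w - z j)\<^sup>2)"
      using Cauchy_derivative_integral_circlepath[OF holomorphic_on_imp_continuous_on[OF h] holomorphic_on_subset[OF h ball_subset_cball] zb]
      by (auto dest!: DERIV_imp_deriv)
    then show ?thesis by simp
  qed
  have sep: "(\<lambda>w. ?D (z(i := w))) holomorphic_on ball (complex_of_real (c i)) (r i)"
    if z: "z \<in> polydisc I c r" and i: "i \<in> I" for z i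
  proof (cases "i = j")
    case True
    then show ?thesis using holomorphic_deriv[OF hf[OF z i]] by simp
  next
    case False
    have "z j \<in> ball (complex_of_real (c j)) (r j)" using z j by (auto simp: polydisc_def)
    then obtain \<rho> where \<rho>: "\<rho> > 0" "cball (z j) \<rho> \<subseteq> ball (complex_of_real (c j)) (r j)"
      by (meson open_ball open_contains_cball)
    have "(\<lambda>y. contour_integral (circlepath (z j) \<rho>) (\<lambda>w. f (z(i := y, j := w)) / (w - z j)\<^sup>2) / (2 * of_real pi * \<i>))
       holomorphic_on ball (complex_of_real (c i)) (r i)"
    proof (intro holomorphic_intros holomorphic_on_circle_integral \<rho>(1))
      have "continuous_on (ball (complex_of_real (c i)) (r i) \<times> sphere (z j) \<rho>) (\<lambda>p. f (z(i := fst p, j := snd p)))"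
      proof (rule continuous_on_compose2[OF ctf])
        show "continuous_on (ball (complex_of_real (c i)) (r i) \<times> sphere (z j) \<rho>) (\<lambda>p. z(i := fst p, j := snd p))"
        proof (rule continuous_on_coordinatewise_then_product)
          fix m show "continuous_on (ball (complex_of_real (c i)) (r i) \<times> sphere (z j) \<rho>) (\<lambda>p. (z(i := fst p, j := snd p)) m)"
            by (cases "m = j"; cases "m = i") (auto intro!: continuous_intros)
        qed
        show "(\<lambda>p. z(i := fst p, j := snd p)) ` (ball (complex_of_real (c i)) (r i) \<times> sphere (z j) \<rho>) \<subseteq> polydisc I c r"
        proof safe
          fix y w assume "y \<in> ball (complex_of_real (c i)) (r i)" "w \<in> sphere (z j) \<rho>"
          moreover then have "w \<in> ball (complex_of_real (c j)) (r j)" using \<rho>(2) by auto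
          ultimately show "z(i := fst (y, w), j := snd (y, w)) \<in> polydisc I c r"
            using z by (simp add: polydisc_upd del: mem_ball)
        qed
      qed
      then show "continuous_on (ball (complex_of_real (c i)) (r i) \<times> sphere (z j) \<rho>)
          (\<lambda>(y, w). f (z(i := y, j := w)) / (w - z j)\<^sup>2)"
        using \<rho>(1) by (auto simp: case_prod_unfold intro!: continuous_intros)
      fix w assume w: "w \<in> sphere (z j) \<rho>"
      then have w': "w \<in> ball (complex_of_real (c j)) (r j)" using \<rho>(2) by auto
      have "z(i := y, j := w) = z(j := w, i := y)" for y using False by auto
      then show "(\<lambda>y. f (z(i := y, j := w))) holomorphic_on ball (complex_of_real (c i)) (r i)"
        using hf[OF polydisc_upd[OF z w'] i] by simp
      show "(w - z j)\<^sup>2 \<noteq> 0" using w \<rho>(1) by auto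
    qed auto
    moreover have "?D (z(i := y)) = contour_integral (circlepath (z j) \<rho>) (\<lambda>w. f (z(i := y, j := w)) / (w - z j)\<^sup>2) / (2 * of_real pi * \<i>)"
      if "y \<in> ball (complex_of_real (c i)) (r i)" for y
      using cauchy[OF polydisc_upd[OF z that] \<rho>(2)] \<rho>(1) False by simp
    ultimately show ?thesis by (rule holomorphic_transform[OF _ sym])
  qed
  have "continuous (at z0) ?D" if z0: "z0 \<in> polydisc I c r" for z0
  proof -
    have "z0 j \<in> ball (complex_of_real (c j)) (r j)" using z0 j by (auto simp: polydisc_def)
    then obtain \<rho> where \<rho>: "\<rho> > 0" "cball (z0 j) \<rho> \<subseteq> ball (complex_of_real (c j)) (r j)"
      by (meson open_ball open_contains_cball)
    \<comment> \<open>On this neighbourhood of \<open>z0\<close> a single circle, centred at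
      \<open>z0 j\<close>, encloses every \<open>z j\<close>, so one integral formula represents the
      derivative throughout.\<close>
    define U where "U = polydisc I c r \<inter> (\<lambda>z. z j) -` ball (z0 j) \<rho>"
    have U: "open U" unfolding U_def
      by (intro open_Int open_polydisc I open_vimage open_ball) simp
    have "continuous_on U (\<lambda>z. contour_integral (circlepath (z0 j) \<rho>) (\<lambda>w. f (z(j := w)) / (w - z j)\<^sup>2) / (2 * of_real pi * \<i>))"
    proof (intro continuous_intros continuous_on_circle_integral)
      have "continuous_on (U \<times> sphere (z0 j) \<rho>) (\<lambda>p. f ((fst p)(j := snd p)))"
      proof (rule continuous_on_compose2[OF ctf continuous_on_fun_upd_pair], safe)
        fix z w assume "z \<in> U" "w \<in> sphere (z0 j) \<rho>"
        moreover then have "w \<in> ball (complex_of_real (c j)) (r j)" using \<rho>(2) by auto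
        ultimately show "(fst (z, w))(j := snd (z, w)) \<in> polydisc I c r"
          by (simp add: U_def polydisc_upd del: mem_ball)
      qed
      moreover have "continuous_on (U \<times> sphere (z0 j) \<rho>) (\<lambda>p. fst p j)"
        by (rule continuous_on_product_then_coordinatewise[OF continuous_on_fst[OF continuous_on_id]])
      ultimately show "continuous_on (U \<times> sphere (z0 j) \<rho>) (\<lambda>(z, w). f (z(j := w)) / (w - z j)\<^sup>2)"
        by (auto simp: case_prod_unfold U_def intro!: continuous_intros)
    qed (use \<rho> in auto)
    then have "continuous_on U ?D"
      by (rule continuous_on_eq) (use cauchy[OF _ \<rho>(2)] in \<open>auto simp: U_def\<close>)
    moreover have "z0 \<in> U" using z0 \<rho>(1) by (simp add: U_def)
    ultimately show ?thesis using U continuous_on_eq_continuous_at by blast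
  qed
  then have "continuous_on (polydisc I c r) ?D"
    by (simp add: continuous_at_imp_continuous_on)
  with d sep show ?thesis by (simp add: hol_def)
qed

section \<open>Terms denoting holomorphic functions\<close>

text \<open>\<open>Const\<close> refers to an enumeration of the admissible constants. \<open>Ren\<close> renames variables and
  shifts them by rationals. \<open>Cint\<close> binds its variable, over which it integrates. Evaluation is total;
  regularity of a term on a polydisc is always stated separately by \<open>hol\<close>.\<close>

datatype tm = Const nat | Var nat | Add tm tm | Mult tm tm | Inv tm | Der nat tm
  | Cint nat rat rat tm | Sub nat rat tm | Ren "(nat \<times> rat) list" tm | Star tm

instance tm :: countable by countable_datatype

abbreviation cx :: "(nat \<Rightarrow> real) \<Rightarrow> nat \<Rightarrow> complex" where
  "cx \<tau> \<equiv> (\<lambda>i. complex_of_real (\<tau> i))"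

lemma complex_of_real_of_rat: "complex_of_real (of_rat q) = of_rat q"
  by (cases q) (simp add: of_rat_rat)

definition rbox :: "nat set \<Rightarrow> (nat \<Rightarrow> real) \<Rightarrow> (nat \<Rightarrow> real) \<Rightarrow> (nat \<Rightarrow> real) set" where
  "rbox I c r = {\<tau>. \<forall>i\<in>I. \<tau> i \<in> ball (c i) (r i)}"

lemma of_real_mem_ball: "complex_of_real x \<in> ball (complex_of_real a) s \<longleftrightarrow> x \<in> ball a s"
  by (simp add: dist_norm flip: of_real_diff)

lemma cx_mem_polydisc: "cx \<tau> \<in> polydisc I c r \<longleftrightarrow> \<tau> \<in> rbox I c r"
  by (simp add: polydisc_def rbox_def of_real_mem_ball del: mem_ball)

text \<open>The default 0 for \<open>Ren\<close> beyond the end of its list does no harm: a term of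
  interest depends on finitely many coordinates, and the list is chosen long enough to cover
  them.\<close>

primrec ev :: "(nat \<Rightarrow> real) \<Rightarrow> tm \<Rightarrow> (nat \<Rightarrow> complex) \<Rightarrow> complex" where
  "ev \<kappa> (Const n) = (\<lambda>z. of_real (\<kappa> n))"
| "ev \<kappa> (Var i) = (\<lambda>z. z i)"
| "ev \<kappa> (Add s t) = (\<lambda>z. ev \<kappa> s z + ev \<kappa> t z)"
| "ev \<kappa> (Mult s t) = (\<lambda>z. ev \<kappa> s z * ev \<kappa> t z)"
| "ev \<kappa> (Inv t) = (\<lambda>z. inverse (ev \<kappa> t z))"
| "ev \<kappa> (Der j t) = (\<lambda>z. deriv (\<lambda>w. ev \<kappa> t (z(j := w))) (z j))"
| "ev \<kappa> (Cint j a \<rho> t) = (\<lambda>z. contour_integral (circlepath (of_rat a) (of_rat \<rho>)) (\<lambda>w. ev \<kappa> t (z(j := w))))"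
| "ev \<kappa> (Sub j q t) = (\<lambda>z. ev \<kappa> t (z(j := of_rat q)))"
| "ev \<kappa> (Ren l t) = (\<lambda>z. ev \<kappa> t (\<lambda>i. if i < length l then z (fst (l ! i)) + of_rat (snd (l ! i)) else 0))"
| "ev \<kappa> (Star t) = (\<lambda>z. cnj (ev \<kappa> t (\<lambda>i. cnj (z i))))"

section \<open>Zeros of terms as values of terms\<close>

text \<open>Write \<open>G w = (w - x) * H w\<close> with \<open>H\<close> free of zeros on the
  closed disc, and apply Cauchy's integral formula to \<open>f / H\<close> at \<open>x\<close>, for
  \<open>f\<close> the identity and for \<open>f = 1\<close>. The quotient of the two integrals is
  the zero \<open>x\<close>.\<close>

lemma simple_root_integrals:
  assumes G: "G holomorphic_on ball b s" and sub: "cball a \<rho> \<subseteq> ball b s" and x: "x \<in> ball a \<rho>"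
    and G0: "G x = 0" and G': "deriv G x \<noteq> 0" and nz: "\<And>w. w \<in> cball a \<rho> \<Longrightarrow> w \<noteq> x \<Longrightarrow> G w \<noteq> 0"
  shows "contour_integral (circlepath a \<rho>) (\<lambda>w. w * inverse (G w)) = 2 * of_real pi * \<i> * x / deriv G x"
    and "contour_integral (circlepath a \<rho>) (\<lambda>w. inverse (G w)) = 2 * of_real pi * \<i> / deriv G x"
proof -
  define H where "H w = (if w = x then deriv G x else (G w - G x) / (w - x))" for w
  have x': "x \<in> ball b s" using x sub ball_subset_cball by blast
  have "H holomorphic_on ball b s"
    unfolding H_def by (rule pole_lemma[OF G]) (use x' in simp)
  then have H: "H holomorphic_on cball a \<rho>" using sub holomorphic_on_subset by blast
  have Hnz: "H w \<noteq> 0" if "w \<in> cball a \<rho>" for w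
    using nz[OF that] G' by (auto simp: H_def G0)
  have Geq: "G w = (w - x) * H w" for w by (simp add: H_def G0)
  have *: "contour_integral (circlepath a \<rho>) (\<lambda>w. f w * inverse (G w)) = 2 * of_real pi * \<i> * f x / deriv G x"
    if f: "f holomorphic_on cball a \<rho>" for f
  proof -
    have "((\<lambda>w. (f w / H w) / (w - x)) has_contour_integral (2 * of_real pi * \<i> * (f x / H x))) (circlepath a \<rho>)"
      by (rule Cauchy_integral_circlepath_simple) (use f H Hnz x in \<open>auto simp: dist_norm norm_minus_commute intro!: holomorphic_intros\<close>)
    moreover have "(f w / H w) / (w - x) = f w * inverse (G w)" for w
      by (simp add: Geq field_simps)
    ultimately show ?thesis using contour_integral_unique by (simp add: H_def)
  qed
  show "contour_integral (circlepath a \<rho>) (\<lambda>w. w * inverse (G w)) = 2 * of_real pi * \<i> * x / deriv G x"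
    by (rule *) (auto intro: holomorphic_intros)
  show "contour_integral (circlepath a \<rho>) (\<lambda>w. inverse (G w)) = 2 * of_real pi * \<i> / deriv G x"
    using *[of "\<lambda>_. 1"] by simp
qed

text \<open>If no derivative of \<open>g\<close> had a simple zero at \<open>x\<close>, all
  derivatives would vanish there by induction, and \<open>g\<close> would vanish on the disc by the
  identity theorem.\<close>

lemma higher_deriv_simple_root:
  assumes g: "g holomorphic_on ball b s" and x: "x \<in> ball b s" and g0: "g x = 0"
    and y: "y \<in> ball b s" "g y \<noteq> 0"
  shows "\<exists>m. (deriv ^^ m) g x = 0 \<and> deriv ((deriv ^^ m) g) x \<noteq> 0"
proof (rule ccontr)
  assume *: "\<not> ?thesis"
  have "(deriv ^^ m) g x = 0" for m
    by (induction m) (use g0 * in auto)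
  then have "g y = 0"
    using holomorphic_fun_eq_0_on_connected[OF g open_ball connected_ball _ x y(1)] by blast
  with y show False by simp
qed

lemma simple_root_isolated:
  assumes G: "G holomorphic_on ball b s" and x: "x \<in> ball b s"
    and G0: "G x = 0" and G': "deriv G x \<noteq> 0"
  obtains e where "e > 0" "ball x e \<subseteq> ball b s" "\<And>w. w \<in> ball x e \<Longrightarrow> w \<noteq> x \<Longrightarrow> G w \<noteq> 0"
proof -
  have "\<exists>y\<in>ball b s. G y \<noteq> 0"
  proof (rule ccontr)
    assume "\<not> ?thesis"
    then have "deriv G x = deriv (\<lambda>_. 0) x"
      using x by (intro deriv_cong_ev eventually_nhds_in_open[THEN eventually_mono, of "ball b s"]) auto
    with G' show False by simp
  qed
  then obtain y where "y \<in> ball b s" "G y \<noteq> 0" by blast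
  then show ?thesis
    using isolated_zeros[OF G open_ball connected_ball x G0, of y thesis] that by simp
qed

text \<open>An open set of the product topology may also restrict coordinates outside
  \<open>I\<close>; these are pinned to the values of \<tau>, and only those in \<open>I\<close> may
  move.\<close>

lemma polydisc_nbhd:
  assumes X: "open X" "cx \<tau> \<in> X" and I: "finite I"
  shows "\<exists>e>0. \<forall>z\<in>polydisc I \<tau> (\<lambda>_. e). (\<lambda>i. if i \<in> I then z i else cx \<tau> i) \<in> X"
proof -
  have "openin (product_topology (\<lambda>i. euclidean) UNIV) X"
    using X(1) unfolding open_fun_def .
  from product_topology_open_contains_basis[OF this X(2)] obtain A where
    A: "cx \<tau> \<in> Pi\<^sub>E UNIV A" "\<forall>i. openin euclidean (A i)" "Pi\<^sub>E UNIV A \<subseteq> X" by blast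
  have Aopen: "open (A i)" for i using A(2) by simp
  have Amem: "complex_of_real (\<tau> i) \<in> A i" for i using PiE_mem[OF A(1) UNIV_I] .
  have "\<exists>e>0. ball (complex_of_real (\<tau> i)) e \<subseteq> A i" for i
    using Aopen Amem open_contains_ball by blast
  then obtain d where d: "\<And>i. d i > 0" "\<And>i. ball (complex_of_real (\<tau> i)) (d i) \<subseteq> A i" by metis
  \<comment> \<open>The 1 keeps the minimum defined when \<open>I\<close> is empty.\<close>
  define e where "e = Min (insert 1 (d ` I))"
  have e: "e > 0" "\<And>i. i \<in> I \<Longrightarrow> e \<le> d i"
    using I d(1) by (auto simp: e_def)
  have "(\<lambda>i. if i \<in> I then z i else cx \<tau> i) \<in> X" if z: "z \<in> polydisc I \<tau> (\<lambda>_. e)" for z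
  proof (rule subsetD[OF A(3)], rule PiE_I)
    fix i show "(if i \<in> I then z i else cx \<tau> i) \<in> A i"
    proof (cases "i \<in> I")
      case True
      then have "z i \<in> ball (complex_of_real (\<tau> i)) (d i)"
        using z e(2)[OF True] by (auto simp: polydisc_def)
      then show ?thesis using d(2)[of i] True by (auto simp del: mem_ball)
    next
      case False
      then show ?thesis using Amem by simp
    qed
  qed simp
  then show ?thesis using e(1) by blast
qed

lemma hol_nonzero_nbhd:
  assumes f: "hol I c r f" and I: "finite I" and \<tau>: "\<tau> \<in> rbox I c r" and nz: "f (cx \<tau>) \<noteq> 0"
  shows "\<exists>e>0. \<forall>z\<in>polydisc I \<tau> (\<lambda>_. e). z \<in> polydisc I c r \<and> f z \<noteq> 0"
proof -
  define X where "X = polydisc I c r \<inter> f -` (- {0})"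
  have "open X" unfolding X_def
    using f I by (intro continuous_open_preimage open_polydisc) (auto simp: hol_def)
  moreover have "cx \<tau> \<in> X" using \<tau> nz by (simp add: X_def cx_mem_polydisc)
  ultimately obtain e where e: "e > 0"
    "\<forall>z\<in>polydisc I \<tau> (\<lambda>_. e). (\<lambda>i. if i \<in> I then z i else cx \<tau> i) \<in> X"
    using polydisc_nbhd I by blast
  have "z \<in> polydisc I c r \<and> f z \<noteq> 0" if z: "z \<in> polydisc I \<tau> (\<lambda>_. e)" for z
  proof -
    have zX: "(\<lambda>i. if i \<in> I then z i else cx \<tau> i) \<in> X" using e(2) z by blast
    have "f z = f (\<lambda>i. if i \<in> I then z i else cx \<tau> i)"
      by (rule depends_onD[of I]) (use f in \<open>auto simp: hol_def\<close>)
    then show ?thesis using zX by (simp add: polydisc_def X_def)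
  qed
  then show ?thesis using e(1) by blast
qed

lemma ev_funpow_Der:
  "ev \<kappa> ((Der j ^^ m) t) (z(j := w)) = (deriv ^^ m) (\<lambda>w. ev \<kappa> t (z(j := w))) w"
proof (induction m arbitrary: w)
  case (Suc m)
  have "(\<lambda>w. ev \<kappa> ((Der j ^^ m) t) (z(j := w))) = (deriv ^^ m) (\<lambda>w. ev \<kappa> t (z(j := w)))"
    using Suc by blast
  then show ?case by (simp add: fun_upd_same del: fun_upd_apply)
qed simp

lemma hol_funpow_Der:
  assumes "hol I c r (ev \<kappa> t)" "j \<in> I" "finite I"
  shows "hol I c r (ev \<kappa> ((Der j ^^ m) t))"
  by (induction m) (use assms in \<open>auto intro: hol_deriv\<close>)

text \<open>Contours need rational data so that there are only countably many terms. A centre within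
  \<open>e/4\<close> of \<open>y\<close> and a radius between \<open>e/4\<close> and
  \<open>e/2\<close> enclose \<open>y\<close> and stay within \<open>3e/4\<close> of it.\<close>

lemma rational_disc_around:
  fixes y e :: real
  assumes "e > 0"
  obtains a \<rho> :: rat where "\<rho> > 0" "y \<in> ball (of_rat a) (of_rat \<rho>)"
    "cball (complex_of_real (of_rat a)) (of_rat \<rho>) \<subseteq> ball (complex_of_real y) e"
proof -
  obtain a where a: "y - e/4 < of_rat a" "of_rat a < y + e/4"
    using of_rat_dense[of "y - e/4" "y + e/4"] assms by auto
  obtain \<rho> where \<rho>: "e/4 < of_rat \<rho>" "of_rat \<rho> < e/2"
    using of_rat_dense[of "e/4" "e/2"] assms by auto
  have "0 < (of_rat \<rho> :: real)" using \<rho> assms by linarith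
  then have "\<rho> > 0" by simp
  moreover have "y \<in> ball (of_rat a) (of_rat \<rho>)"
    using a \<rho> by (simp add: dist_real_def)
  moreover have "cball (complex_of_real (of_rat a)) (of_rat \<rho>) \<subseteq> ball (complex_of_real y) e"
  proof
    fix w assume "w \<in> cball (complex_of_real (of_rat a)) (of_rat \<rho>)"
    moreover have "\<bar>y - of_rat a\<bar> < e/4" using a by linarith
    then have "dist (complex_of_real y) (complex_of_real (of_rat a)) < e/4"
      by (simp add: dist_norm flip: of_real_diff)
    ultimately show "w \<in> ball (complex_of_real y) e"
      using dist_triangle[of "complex_of_real y" w "complex_of_real (of_rat a)"] \<rho> by simp
  qed
  ultimately show ?thesis using that by blast
qed

text \<open>An implicit function theorem for terms. With the other variables fixed, \<open>t\<close>
  is not identically zero in variable \<open>j\<close>, so some derivative \<open>G\<close> of it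
  has a simple zero at \<open>\<tau> j\<close>. That zero is the quotient of the integrals of
  \<open>w / G\<close> and \<open>1 / G\<close> over a small circle, a term in which variable
  \<open>j\<close> is bound.\<close>

lemma root_as_term:
  assumes one: "\<kappa> one = 1"
    and t: "hol I c r (ev \<kappa> t)" and I: "finite I" "j \<in> I" and \<tau>: "\<tau> \<in> rbox I c r"
    and zero: "ev \<kappa> t (cx \<tau>) = 0"
    and y: "y \<in> ball (complex_of_real (c j)) (r j)" "ev \<kappa> t ((cx \<tau>)(j := y)) \<noteq> 0"
  shows "\<exists>t' c' r'. hol (I - {j}) c' r' (ev \<kappa> t') \<and> \<tau> \<in> rbox (I - {j}) c' r' \<and>
    ev \<kappa> t' (cx \<tau>) = of_real (\<tau> j)"
proof -
  let ?B = "ball (complex_of_real (c j)) (r j)" and ?x = "complex_of_real (\<tau> j)" and ?J = "I - {j}"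
  have \<tau>': "cx \<tau> \<in> polydisc I c r" using \<tau> by (simp add: cx_mem_polydisc)
  have x: "?x \<in> ?B" using \<tau>' I(2) by (auto simp: polydisc_def)
  define g where "g w = ev \<kappa> t ((cx \<tau>)(j := w))" for w
  have upd: "(cx \<tau>)(j := ?x) = cx \<tau>" by auto
  have g: "g holomorphic_on ?B" using t \<tau>' I(2) unfolding g_def hol_def by blast
  have "g ?x = 0" using zero upd by (simp add: g_def)
  then obtain m where m: "(deriv ^^ m) g ?x = 0" "deriv ((deriv ^^ m) g) ?x \<noteq> 0"
    using higher_deriv_simple_root[OF g x _ y(1)] y(2) by (auto simp: g_def)
  define G where "G = ev \<kappa> ((Der j ^^ m) t)"
  have hG: "hol I c r G" unfolding G_def by (rule hol_funpow_Der[OF t I(2,1)])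
  have Gg: "(\<lambda>w. G ((cx \<tau>)(j := w))) = (deriv ^^ m) g"
    unfolding G_def g_def by (rule ext) (rule ev_funpow_Der)
  have "(\<lambda>w. G ((cx \<tau>)(j := w))) holomorphic_on ?B" using hG \<tau>' I(2) unfolding hol_def by blast
  then have hGg: "(deriv ^^ m) g holomorphic_on ?B" by (simp add: Gg)
  obtain e where e: "e > 0" "ball ?x e \<subseteq> ?B"
    "\<And>w. w \<in> ball ?x e \<Longrightarrow> w \<noteq> ?x \<Longrightarrow> (deriv ^^ m) g w \<noteq> 0"
    using simple_root_isolated[OF hGg x m] by blast
  obtain a \<rho> where a\<rho>: "\<rho> > 0" "\<tau> j \<in> ball (of_rat a) (of_rat \<rho>)"
    and asub: "cball (complex_of_real (of_rat a)) (of_rat \<rho>) \<subseteq> ball ?x e"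
    using rational_disc_around[OF e(1), of "\<tau> j"] by blast
  let ?S = "sphere (complex_of_real (of_rat a)) (of_rat \<rho>)"
  have \<rho>0: "0 < (of_rat \<rho> :: real)" using a\<rho>(1) by simp
  have xa: "?x \<in> ball (complex_of_real (of_rat a)) (of_rat \<rho>)"
    using a\<rho>(2) of_real_mem_ball by blast
  have Sx: "?x \<notin> ?S" using xa by auto
  have Ssub: "?S \<subseteq> ?B"
    using sphere_cball asub e(2) by (meson subset_trans)
  have nzS: "G ((cx \<tau>)(j := w)) \<noteq> 0" if "w \<in> ?S" for w
  proof -
    have "w \<in> ball ?x e" using that asub sphere_cball by blast
    moreover have "w \<noteq> ?x" using Sx that by blast
    ultimately show ?thesis using e(3)[of w] fun_cong[OF Gg, of w] by simp
  qed
  define X where "X = polydisc I c r \<inter> G -` (- {0})"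
  have X: "open X" unfolding X_def
    using hG I by (intro continuous_open_preimage open_polydisc) (auto simp: hol_def)
  define W where "W = (\<lambda>p. (fst p)(j := snd p)) -` X"
  have "open W" unfolding W_def
    using continuous_on_fun_upd_pair by (rule open_vimage[OF X])
  moreover have "{cx \<tau>} \<times> ?S \<subseteq> W"
    using nzS Ssub polydisc_upd[OF \<tau>'] by (auto simp: W_def X_def)
  \<comment> \<open>The circle is compact, so by the tube lemma \<open>G\<close> stays nonzero on
    all of it while the other variables move a little.\<close>
  ultimately obtain X0 where X0: "cx \<tau> \<in> X0" "open X0" "X0 \<times> ?S \<subseteq> W"
    using Elementary_Topology.tube_lemma[of ?S W "cx \<tau>"] by auto
  obtain e1 where e1: "e1 > 0" "\<forall>z\<in>polydisc ?J \<tau> (\<lambda>_. e1). (\<lambda>i. if i \<in> ?J then z i else cx \<tau> i) \<in> X0"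
    using polydisc_nbhd[OF X0(2,1), of ?J] I by blast
  have inX: "z(j := w) \<in> X" if z: "z \<in> polydisc ?J \<tau> (\<lambda>_. e1)" and w: "w \<in> ?S" for z w
  proof -
    let ?z = "\<lambda>i. if i \<in> ?J then z i else cx \<tau> i"
    have "?z \<in> X0" using e1(2) z by blast
    then have "(?z, w) \<in> W" using X0(3) w by blast
    then have X: "?z(j := w) \<in> X" by (simp add: W_def)
    have "G (z(j := w)) = G (?z(j := w))"
      by (rule depends_onD[of I]) (use hG in \<open>auto simp: hol_def\<close>)
    then show ?thesis using X by (auto simp: X_def polydisc_def split: if_splits)
  qed
  have inX': "z \<in> X" if "z \<in> polydisc ?J \<tau> (\<lambda>_. e1)" "z j \<in> ?S" for z
    using inX[OF that] by simp
  have int: "hol ?J \<tau> (\<lambda>_. e1) (\<lambda>z. contour_integral (circlepath (complex_of_real (of_rat a)) (of_rat \<rho>))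
      (\<lambda>w. h (z(j := w)) * inverse (G (z(j := w)))))" if h: "hol I c r h" for h
  proof (rule hol_circle_integral[OF _ _ \<rho>0])
    have "depends_on I h" "depends_on I G" using h hG by (auto simp: hol_def)
    then have "depends_on I (\<lambda>z. h z * inverse (G z))" unfolding depends_on_def by metis
    then show "depends_on (insert j ?J) (\<lambda>z. h z * inverse (G z))"
      using I(2) by (simp add: insert_absorb)
    let ?V = "{z \<in> polydisc ?J \<tau> (\<lambda>_. e1). z j \<in> ?S}"
    have V: "?V \<subseteq> X" using inX' by auto
    then have "continuous_on ?V h" "continuous_on ?V G"
      using h hG by (auto simp: hol_def X_def intro: continuous_on_subset)
    then show "continuous_on ?V (\<lambda>z. h z * inverse (G z))"
      using V by (intro continuous_intros) (auto simp: X_def)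
    fix z i assume z: "z \<in> polydisc ?J \<tau> (\<lambda>_. e1)" "z j \<in> ?S" and i: "i \<in> ?J"
    have zp: "z \<in> polydisc I c r" using inX'[OF z] by (simp add: X_def)
    have updX: "z(i := w) \<in> X" if "w \<in> ball (complex_of_real (\<tau> i)) e1" for w
      using inX'[of "z(i := w)"] polydisc_upd[OF z(1), of w i] z(2) i that by auto
    then have sub: "ball (complex_of_real (\<tau> i)) e1 \<subseteq> ball (complex_of_real (c i)) (r i)"
      using i by (auto simp: X_def polydisc_def) (metis fun_upd_same)
    have "(\<lambda>w. h (z(i := w))) holomorphic_on ball (complex_of_real (\<tau> i)) e1"
      "(\<lambda>w. G (z(i := w))) holomorphic_on ball (complex_of_real (\<tau> i)) e1"
      using h hG zp i by (auto simp: hol_def intro!: holomorphic_on_subset[OF _ sub])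
    then show "(\<lambda>w. h (z(i := w)) * inverse (G (z(i := w)))) holomorphic_on ball (complex_of_real (\<tau> i)) e1"
      using updX by (intro holomorphic_intros) (auto simp: X_def)
  qed simp
  \<comment> \<open>Numerator and denominator of the quotient. At \<tau> they share the factor 2 pi
    i divided by the derivative at the simple zero, which cancels.\<close>
  define N where "N = Cint j a \<rho> (Mult (Var j) (Inv ((Der j ^^ m) t)))"
  define D where "D = Cint j a \<rho> (Mult (Const one) (Inv ((Der j ^^ m) t)))"
  have hN: "hol ?J \<tau> (\<lambda>_. e1) (ev \<kappa> N)"
    using int[OF hol_var[OF I(2)]] by (simp add: N_def G_def complex_of_real_of_rat)
  have hD: "hol ?J \<tau> (\<lambda>_. e1) (ev \<kappa> D)"
    using int[OF hol_const[of _ _ _ 1]] by (simp add: D_def G_def one complex_of_real_of_rat)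
  have vals: "ev \<kappa> N (cx \<tau>) = 2 * of_real pi * \<i> * ?x / deriv ((deriv ^^ m) g) ?x"
      "ev \<kappa> D (cx \<tau>) = 2 * of_real pi * \<i> / deriv ((deriv ^^ m) g) ?x"
  proof -
    have nz: "(deriv ^^ m) g w \<noteq> 0" if "w \<in> cball (complex_of_real (of_rat a)) (of_rat \<rho>)" "w \<noteq> ?x" for w
      using e(3) asub that by blast
    note si = simple_root_integrals[OF hGg subset_trans[OF asub e(2)] xa m nz]
    have Gg': "ev \<kappa> ((Der j ^^ m) t) ((cx \<tau>)(j := w)) = (deriv ^^ m) g w" for w
      using fun_cong[OF Gg, of w] by (simp add: G_def)
    show "ev \<kappa> N (cx \<tau>) = 2 * of_real pi * \<i> * ?x / deriv ((deriv ^^ m) g) ?x"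
      using si(1) by (simp add: N_def Gg' complex_of_real_of_rat del: fun_upd_apply add: fun_upd_same)
    show "ev \<kappa> D (cx \<tau>) = 2 * of_real pi * \<i> / deriv ((deriv ^^ m) g) ?x"
      using si(2) by (simp add: D_def Gg' one complex_of_real_of_rat del: fun_upd_apply)
  qed
  have D0: "ev \<kappa> D (cx \<tau>) \<noteq> 0" using vals(2) m(2) by simp
  have \<tau>J: "\<tau> \<in> rbox ?J \<tau> (\<lambda>_. e1)" using e1(1) by (simp add: rbox_def)
  obtain e2 where e2: "e2 > 0" "\<forall>z\<in>polydisc ?J \<tau> (\<lambda>_. e2). z \<in> polydisc ?J \<tau> (\<lambda>_. e1) \<and> ev \<kappa> D z \<noteq> 0"
    using hol_nonzero_nbhd[OF hD _ \<tau>J D0] I(1) by blast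
  define e3 where "e3 = min e1 e2"
  have "hol ?J \<tau> (\<lambda>_. e3) (ev \<kappa> N)" "hol ?J \<tau> (\<lambda>_. e3) (ev \<kappa> D)"
    by (rule hol_mono[OF hN]; auto simp: e3_def) (rule hol_mono[OF hD]; auto simp: e3_def)
  moreover have "ev \<kappa> D z \<noteq> 0" if "z \<in> polydisc ?J \<tau> (\<lambda>_. e3)" for z
    using that e2(2) by (auto simp: polydisc_def e3_def)
  ultimately have "hol ?J \<tau> (\<lambda>_. e3) (ev \<kappa> (Mult N (Inv D)))"
    by (simp add: hol_mult hol_inverse)
  moreover have "\<tau> \<in> rbox ?J \<tau> (\<lambda>_. e3)" using e1(1) e2(1) by (simp add: rbox_def e3_def)
  moreover have "ev \<kappa> (Mult N (Inv D)) (cx \<tau>) = ?x"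
    using m(2) by (simp add: vals field_simps)
  ultimately show ?thesis by blast
qed

section \<open>Independent sets of reals\<close>

text \<open>The analogue of algebraic independence with holomorphic terms in place of polynomials;
  \<open>spans\<close> is the matching closure operator.\<close>

definition indep :: "(nat \<Rightarrow> real) \<Rightarrow> real set \<Rightarrow> bool" where
  "indep \<kappa> T \<longleftrightarrow> (\<forall>t I c r \<tau> \<sigma>. finite I \<longrightarrow> hol I c r (ev \<kappa> t) \<longrightarrow> inj_on \<tau> I \<longrightarrow> \<tau> ` I \<subseteq> T \<longrightarrow>
     \<tau> \<in> rbox I c r \<longrightarrow> \<sigma> \<in> rbox I c r \<longrightarrow> ev \<kappa> t (cx \<tau>) = 0 \<longrightarrow> ev \<kappa> t (cx \<sigma>) = 0)"

definition spans :: "(nat \<Rightarrow> real) \<Rightarrow> real set \<Rightarrow> real \<Rightarrow> bool" where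
  "spans \<kappa> V x \<longleftrightarrow> (\<exists>t I c r \<tau>. finite I \<and> hol I c r (ev \<kappa> t) \<and> inj_on \<tau> I \<and> \<tau> ` I \<subseteq> V \<and>
     \<tau> \<in> rbox I c r \<and> ev \<kappa> t (cx \<tau>) = of_real x)"

lemma indepD:
  assumes "indep \<kappa> T" "finite I" "hol I c r (ev \<kappa> t)" "inj_on \<tau> I" "\<tau> ` I \<subseteq> T"
    "\<tau> \<in> rbox I c r" "\<sigma> \<in> rbox I c r" "ev \<kappa> t (cx \<tau>) = 0"
  shows "ev \<kappa> t (cx \<sigma>) = 0"
  using assms unfolding indep_def by blast

lemma indep_empty: "indep \<kappa> {}"
  unfolding indep_def
proof (intro allI impI)
  fix t I c r \<tau> \<sigma> assume a: "hol I c r (ev \<kappa> t)" "\<tau> ` I \<subseteq> {}" "ev \<kappa> t (cx \<tau>) = 0"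
  have "ev \<kappa> t (cx \<sigma>) = ev \<kappa> t (cx \<tau>)"
    by (rule depends_onD[of I]) (use a in \<open>auto simp: hol_def\<close>)
  with a show "ev \<kappa> t (cx \<sigma>) = 0" by simp
qed

text \<open>Zorn's lemma applies because independence has finite character: each instance involves
  finitely many elements, which already lie in one member of a chain.\<close>

lemma maximal_indep:
  obtains T where "indep \<kappa> T" "\<And>x. x \<notin> T \<Longrightarrow> \<not> indep \<kappa> (insert x T)"
proof -
  have "\<exists>M\<in>Collect (indep \<kappa>). \<forall>X\<in>Collect (indep \<kappa>). M \<subseteq> X \<longrightarrow> X = M"
  proof (rule subset_Zorn_nonempty)
    show "Collect (indep \<kappa>) \<noteq> {}" using indep_empty by blast
    fix C assume C: "C \<noteq> {}" "subset.chain (Collect (indep \<kappa>)) C"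
    have "indep \<kappa> (\<Union>C)"
      unfolding indep_def
    proof (intro allI impI)
      fix t I c r \<tau> \<sigma>
      assume a: "finite I" "hol I c r (ev \<kappa> t)" "inj_on \<tau> I" "\<tau> ` I \<subseteq> \<Union> C" "\<tau> \<in> rbox I c r" "\<sigma> \<in> rbox I c r"
        "ev \<kappa> t (cx \<tau>) = 0"
      obtain T where "T \<in> C" "\<tau> ` I \<subseteq> T"
        using finite_subset_Union_chain[OF _ a(4) C] a(1) by blast
      moreover then have "indep \<kappa> T" using C(2) by (auto simp: subset.chain_def)
      ultimately show "ev \<kappa> t (cx \<sigma>) = 0" using indepD a by metis
    qed
    then show "\<Union>C \<in> Collect (indep \<kappa>)" by simp
  qed
  then obtain T where T: "indep \<kappa> T" "\<And>X. indep \<kappa> X \<Longrightarrow> T \<subseteq> X \<Longrightarrow> X = T" by auto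
  show ?thesis
  proof (rule that[OF T(1)])
    fix x assume "x \<notin> T"
    then show "\<not> indep \<kappa> (insert x T)" using T(2)[of "insert x T"] by auto
  qed
qed

lemma spans_member: "x \<in> V \<Longrightarrow> spans \<kappa> V x"
  unfolding spans_def
  by (rule exI[of _ "Var 0"], rule exI[of _ "{0}"], rule exI[of _ "\<lambda>_. x"], rule exI[of _ "\<lambda>_. 1"], rule exI[of _ "\<lambda>_. x"])
    (auto simp: rbox_def intro: hol_var)

text \<open>A failure of independence after adding \<open>x\<close> gives a term that vanishes at
  \<tau>, with \<open>x\<close> as the entry \<open>\<tau> j\<close>, but not at some \<sigma>. If
  the term is not identically zero in variable \<open>j\<close>, then \<open>root_as_term\<close>
  expresses \<open>x\<close>. Otherwise all rational substitutions for variable \<open>j\<close>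
  vanish at \<sigma> as well, and by density and continuity so would the term itself.\<close>

lemma maximal_indep_spans:
  assumes one: "\<kappa> one = 1" and T: "indep \<kappa> T" and max: "\<And>x. x \<notin> T \<Longrightarrow> \<not> indep \<kappa> (insert x T)"
  shows "spans \<kappa> T x"
proof (cases "x \<in> T")
  case False
  then obtain t I c r \<tau> \<sigma> where
    a: "finite I" "hol I c r (ev \<kappa> t)" "inj_on \<tau> I" "\<tau> ` I \<subseteq> insert x T" "\<tau> \<in> rbox I c r" "\<sigma> \<in> rbox I c r"
      "ev \<kappa> t (cx \<tau>) = 0" and nz: "ev \<kappa> t (cx \<sigma>) \<noteq> 0"
    using max[OF False] unfolding indep_def by blast
  have "x \<in> \<tau> ` I"
    using indepD[OF T a(1-3) _ a(5-7)] nz a(4) by blast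
  then obtain j where j: "j \<in> I" "\<tau> j = x" by blast
  let ?J = "I - {j}"
  have J: "finite ?J" "inj_on \<tau> ?J" "\<tau> ` ?J \<subseteq> T" "\<tau> \<in> rbox ?J c r" "\<sigma> \<in> rbox ?J c r"
    using a j by (auto simp: inj_on_def rbox_def)
  have "\<exists>y\<in>ball (complex_of_real (c j)) (r j). ev \<kappa> t ((cx \<tau>)(j := y)) \<noteq> 0"
  proof (rule ccontr)
    assume "\<not> ?thesis"
    then have z: "ev \<kappa> t ((cx \<tau>)(j := y)) = 0" if "y \<in> ball (complex_of_real (c j)) (r j)" for y
      using that by blast
    \<comment> \<open>Substituting a rational for variable \<open>j\<close> removes the only
      parameter outside \<open>T\<close>, so independence of \<open>T\<close> applies.\<close>
    have rat0: "ev \<kappa> t ((cx \<sigma>)(j := of_rat q)) = 0" if q: "of_rat q \<in> ball (c j) (r j)" for q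
    proof -
      have q': "of_rat q \<in> ball (complex_of_real (c j)) (r j)"
        using q of_real_mem_ball[of "of_rat q" "c j" "r j"] by (simp add: complex_of_real_of_rat)
      have "hol ?J c r (ev \<kappa> (Sub j q t))"
        using hol_subst[OF a(2) q'] by simp
      moreover have "ev \<kappa> (Sub j q t) (cx \<tau>) = 0" using z[OF q'] by simp
      ultimately have "ev \<kappa> (Sub j q t) (cx \<sigma>) = 0"
        using indepD[OF T J(1) _ J(2-5)] by blast
      then show ?thesis by simp
    qed
    have \<sigma>j: "\<sigma> j \<in> ball (c j) (r j)" using a(6) j by (auto simp: rbox_def)
    define g where "g x = ev \<kappa> t ((cx \<sigma>)(j := complex_of_real x))" for x
    have "continuous_on (ball (complex_of_real (c j)) (r j)) (\<lambda>w. ev \<kappa> t ((cx \<sigma>)(j := w)))"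
      using a(2,6) j(1) by (intro holomorphic_on_imp_continuous_on) (auto simp: hol_def cx_mem_polydisc)
    then have "continuous_on (ball (c j) (r j)) g"
      unfolding g_def
      by (rule continuous_on_compose2) (auto intro!: continuous_intros simp: of_real_mem_ball simp del: mem_ball)
    then have "isCont g (\<sigma> j)" using \<sigma>j continuous_on_eq_continuous_at open_ball by blast
    moreover have "g (\<sigma> j) \<noteq> 0"
    proof -
      have "(cx \<sigma>)(j := complex_of_real (\<sigma> j)) = cx \<sigma>" by auto
      then show ?thesis using nz by (simp add: g_def)
    qed
    ultimately obtain d where d: "d > 0" "\<And>x. dist (\<sigma> j) x < d \<Longrightarrow> g x \<noteq> 0"
      using continuous_at_avoid[of "\<sigma> j" g 0] by blast
    obtain d' where d': "d' > 0" "ball (\<sigma> j) d' \<subseteq> ball (c j) (r j)"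
      using \<sigma>j open_contains_ball open_ball by metis
    obtain q where q: "\<sigma> j < of_rat q" "of_rat q < \<sigma> j + min d d'"
      using of_rat_dense[of "\<sigma> j" "\<sigma> j + min d d'"] d d' by auto
    then have "dist (\<sigma> j) (of_rat q) < d" "of_rat q \<in> ball (\<sigma> j) d'" by (auto simp: dist_real_def)
    then show False using d(2)[of "of_rat q"] d'(2) rat0[of q] by (auto simp: g_def complex_of_real_of_rat)
  qed
  then obtain y where y: "y \<in> ball (complex_of_real (c j)) (r j)" "ev \<kappa> t ((cx \<tau>)(j := y)) \<noteq> 0" by blast
  obtain t' c' r' where "hol ?J c' r' (ev \<kappa> t')" "\<tau> \<in> rbox ?J c' r'" "ev \<kappa> t' (cx \<tau>) = of_real (\<tau> j)"
    using root_as_term[OF one a(2,1) j(1) a(5,7) y] by blast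
  then show ?thesis unfolding spans_def using J j(2) by blast
qed (rule spans_member)

section \<open>Rational shifts of independent sets\<close>

lemma Ren_term:
  assumes t: "hol I c r (ev \<kappa> t)" and I: "finite I" and l: "inj_on l I" "l ` I \<subseteq> J"
    and sub: "\<And>i w. i \<in> I \<Longrightarrow> w \<in> ball (complex_of_real (c' (l i))) (r' (l i)) \<Longrightarrow>
       w + of_rat (q i) \<in> ball (complex_of_real (c i)) (r i)"
  obtains t' where "hol J c' r' (ev \<kappa> t')" "\<And>z. ev \<kappa> t' z = ev \<kappa> t (\<lambda>i. z (l i) + of_rat (q i))"
proof -
  obtain N where N: "I \<subseteq> {..<N}" using I finite_nat_bounded by auto
  let ?t = "Ren (map (\<lambda>i. (l i, q i)) [0..<N]) t"
  have dep: "depends_on I (ev \<kappa> t)" using t by (simp add: hol_def)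
  have "ev \<kappa> ?t z = ev \<kappa> t (\<lambda>i. z (l i) + of_rat (q i))" for z
    unfolding ev.simps by (rule depends_onD[OF dep]) (use N in auto)
  moreover have "hol J c' r' (\<lambda>z. ev \<kappa> t (\<lambda>i. z (l i) + of_rat (q i)))"
    by (rule hol_comp_shift[OF t l, where q = "\<lambda>i. of_rat (q i)"])
      (use sub in \<open>simp_all add: complex_of_real_of_rat\<close>)
  ultimately show ?thesis using that[of ?t] by simp
qed

lemma shift_ball: "w \<in> ball (complex_of_real (a - of_rat q)) s \<Longrightarrow> w + of_rat q \<in> ball (complex_of_real a) s"
  by (simp add: dist_norm complex_of_real_of_rat algebra_simps)

text \<open>A term at shifted elements is another term, with the rational shifts built in, at the
  original elements; each element may have a shift of its own. The polydisc is moved back by the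
  same rationals.\<close>

lemma indep_shift:
  assumes T: "indep \<kappa> T" and g: "\<And>t. t \<in> T \<Longrightarrow> \<exists>q. g t = t + of_rat q"
  shows "indep \<kappa> (g ` T)"
  unfolding indep_def
proof (intro allI impI)
  fix t I c r \<tau> \<sigma>
  assume a: "finite I" "hol I c r (ev \<kappa> t)" "inj_on \<tau> I" "\<tau> ` I \<subseteq> g ` T" "\<tau> \<in> rbox I c r" "\<sigma> \<in> rbox I c r"
    "ev \<kappa> t (cx \<tau>) = 0"
  have "\<exists>\<theta> q. i \<in> I \<longrightarrow> \<theta> \<in> T \<and> g \<theta> = \<tau> i \<and> \<tau> i = \<theta> + of_rat q" for i
    using a(4) g by (smt (verit, best) image_iff image_subset_iff)
  then obtain \<theta> q where \<theta>: "\<And>i. i \<in> I \<Longrightarrow> \<theta> i \<in> T" "\<And>i. i \<in> I \<Longrightarrow> g (\<theta> i) = \<tau> i"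
    "\<And>i. i \<in> I \<Longrightarrow> \<tau> i = \<theta> i + of_rat (q i)" by metis
  obtain t' where t': "hol I (\<lambda>i. c i - of_rat (q i)) r (ev \<kappa> t')"
    "\<And>z. ev \<kappa> t' z = ev \<kappa> t (\<lambda>i. z i + of_rat (q i))"
    using Ren_term[OF a(2,1), of "\<lambda>i. i" I "\<lambda>i. c i - of_rat (q i)" r q thesis] shift_ball by auto
  have dep: "depends_on I (ev \<kappa> t)" using a(2) by (simp add: hol_def)
  have "ev \<kappa> t' (cx \<theta>) = ev \<kappa> t (cx \<tau>)"
    unfolding t'(2) by (rule depends_onD[OF dep]) (simp add: \<theta>(3) complex_of_real_of_rat)
  then have zero: "ev \<kappa> t' (cx \<theta>) = 0" using a(7) by simp
  have inj: "inj_on \<theta> I" using a(3) \<theta>(2) by (metis inj_on_def)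
  have sub: "\<theta> ` I \<subseteq> T" using \<theta>(1) by blast
  have \<theta>box: "\<theta> \<in> rbox I (\<lambda>i. c i - of_rat (q i)) r"
    using a(5) \<theta>(3) by (simp add: rbox_def dist_norm algebra_simps)
  have "(\<lambda>i. \<sigma> i - of_rat (q i)) \<in> rbox I (\<lambda>i. c i - of_rat (q i)) r"
    using a(6) by (simp add: rbox_def dist_norm)
  from indepD[OF T a(1) t'(1) inj sub \<theta>box this zero]
  show "ev \<kappa> t (cx \<sigma>) = 0" by (simp add: t'(2) complex_of_real_of_rat)
qed

text \<open>Here the term absorbs the inverse shifts, and injectivity of \<open>g\<close> keeps the
  parameters distinct.\<close>

lemma spans_shift:
  assumes x: "spans \<kappa> T x" and g: "\<And>t. t \<in> T \<Longrightarrow> \<exists>q. g t = t + of_rat q" and inj: "inj_on g T"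
  shows "spans \<kappa> (g ` T) x"
proof -
  obtain t I c r \<tau> where a: "finite I" "hol I c r (ev \<kappa> t)" "inj_on \<tau> I" "\<tau> ` I \<subseteq> T" "\<tau> \<in> rbox I c r"
    "ev \<kappa> t (cx \<tau>) = of_real x"
    using x unfolding spans_def by blast
  have "\<forall>i. \<exists>q. i \<in> I \<longrightarrow> \<tau> i = g (\<tau> i) + of_rat q"
  proof
    fix i
    show "\<exists>q. i \<in> I \<longrightarrow> \<tau> i = g (\<tau> i) + of_rat q"
    proof (cases "i \<in> I")
      case True
      then obtain q where "g (\<tau> i) = \<tau> i + of_rat q" using g a(4) by blast
      then have "\<tau> i = g (\<tau> i) + of_rat (- q)" by (simp add: of_rat_minus)
      then show ?thesis by blast
    qed simp
  qed
  then obtain q where q: "\<And>i. i \<in> I \<Longrightarrow> \<tau> i = g (\<tau> i) + of_rat (q i)" by metis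
  obtain t' where t': "hol I (\<lambda>i. c i - of_rat (q i)) r (ev \<kappa> t')"
    "\<And>z. ev \<kappa> t' z = ev \<kappa> t (\<lambda>i. z i + of_rat (q i))"
    using Ren_term[OF a(2,1), of "\<lambda>i. i" I "\<lambda>i. c i - of_rat (q i)" r q thesis] shift_ball by auto
  have dep: "depends_on I (ev \<kappa> t)" using a(2) by (simp add: hol_def)
  have "ev \<kappa> t' (cx (\<lambda>i. g (\<tau> i))) = ev \<kappa> t (cx \<tau>)"
    unfolding t'(2)
  proof (rule depends_onD[OF dep])
    fix i assume "i \<in> I"
    then show "cx (\<lambda>i. g (\<tau> i)) i + of_rat (q i) = cx \<tau> i"
      using arg_cong[OF q, of i complex_of_real] by (simp add: complex_of_real_of_rat)
  qed
  moreover have "inj_on (\<lambda>i. g (\<tau> i)) I"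
    using a(3,4) inj by (auto simp: inj_on_def image_subset_iff)
  moreover have "(\<lambda>i. g (\<tau> i)) \<in> rbox I (\<lambda>i. c i - of_rat (q i)) r"
  proof -
    have "g (\<tau> i) \<in> ball (c i - of_rat (q i)) (r i)" if "i \<in> I" for i
    proof -
      have "\<tau> i \<in> ball (c i) (r i)" using a(5) that by (simp add: rbox_def)
      moreover have "dist (c i - of_rat (q i)) (g (\<tau> i)) = dist (c i) (\<tau> i)"
        using q[OF that] by (simp add: dist_real_def)
      ultimately show ?thesis by simp
    qed
    then show ?thesis by (simp add: rbox_def)
  qed
  moreover have "(\<lambda>i. g (\<tau> i)) ` I \<subseteq> g ` T" using a(4) by auto
  ultimately show ?thesis unfolding spans_def using a(1,6) t'(1) by metis
qed

text \<open>The difference of two variables minus \<open>q\<close> is a term. If it vanished at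
  \<open>(s, t)\<close>, it would have to vanish also at \<open>(s + 1/2, t)\<close>, which is still
  in the polydisc of radius 1. Hence rational shifts cannot make two elements of \<open>T\<close>
  collide.\<close>

lemma indep_diff_irrational:
  assumes rat: "\<And>q. of_rat q \<in> range \<kappa>" and T: "indep \<kappa> T" and st: "s \<in> T" "t \<in> T" "s \<noteq> t"
  shows "s - t \<noteq> of_rat q"
proof
  assume "s - t = of_rat q"
  then have s: "s = t + of_rat q" by simp
  obtain m1 where m1: "\<kappa> m1 = - 1" using rat[of "-1"] by (auto simp: of_rat_minus)
  obtain mq where mq: "\<kappa> mq = - of_rat q" using rat[of "-q"] by (auto simp: of_rat_minus)
  let ?t = "Add (Var 0) (Add (Mult (Const m1) (Var 1)) (Const mq))"
  let ?\<tau> = "\<lambda>i::nat. if i = 0 then s else t" and ?\<sigma> = "\<lambda>i::nat. if i = 0 then s + 1/2 else t"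
  have val: "ev \<kappa> ?t (cx \<tau>) = of_real (\<tau> 0 + (- 1 * \<tau> 1 + - of_rat q))" for \<tau>
    unfolding ev.simps m1 mq by (simp only: of_real_add of_real_mult)
  have h: "hol {0, 1} ?\<tau> (\<lambda>_. 1) (ev \<kappa> ?t)"
    unfolding ev.simps by (intro hol_add hol_mult hol_var hol_const) auto
  have "ev \<kappa> ?t (cx ?\<sigma>) = 0"
  proof (rule indepD[OF T _ h])
    show "ev \<kappa> ?t (cx ?\<tau>) = 0" unfolding val by (simp add: s)
  qed (use st in \<open>auto simp: rbox_def inj_on_def dist_real_def\<close>)
  then show False unfolding val of_real_eq_0_iff by (simp add: s)
qed

section \<open>Cardinality of spanning sets\<close>

lemma times_lepoll_infinite:
  assumes "infinite B" "A \<lesssim> B" "C \<lesssim> B"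
  shows "A \<times> C \<lesssim> B"
proof -
  have "B \<times> B \<approx> B"
    using card_of_Times_same_infinite[OF assms(1)] by (simp add: eqpoll_iff_card_of_ordIso)
  then show ?thesis using times_lepoll_mono[OF assms(2,3)] lepoll_trans eqpoll_imp_lepoll by blast
qed

lemma lists_lepoll_infinite:
  assumes A: "infinite A"
  shows "lists A \<lesssim> A"
proof -
  have L: "{xs \<in> lists A. length xs = n} \<lesssim> A" for n
  proof (induction n)
    case 0
    obtain a where "a \<in> A" using A infinite_imp_nonempty by blast
    then show ?case by (auto simp: lepoll_def inj_on_def intro!: exI[of _ "\<lambda>_. a"])
  next
    case (Suc n)
    have "{xs \<in> lists A. length xs = Suc n} \<subseteq> (\<lambda>(x, xs). x # xs) ` (A \<times> {xs \<in> lists A. length xs = n})"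
      by (auto simp: length_Suc_conv image_iff)
    then have "{xs \<in> lists A. length xs = Suc n} \<lesssim> A \<times> {xs \<in> lists A. length xs = n}"
      by (meson image_lepoll lepoll_trans subset_imp_lepoll)
    also have "\<dots> \<lesssim> A" by (rule times_lepoll_infinite[OF A lepoll_refl Suc])
    finally show ?case .
  qed
  have "(card_of (\<Union>n::nat. {xs \<in> lists A. length xs = n}), card_of A) \<in> ordLeq"
    by (rule card_of_UNION_ordLeq_infinite[OF A])
      (use L A in \<open>auto simp: infinite_iff_card_of_nat lepoll_def card_of_ordLeq[symmetric]\<close>)
  moreover have "lists A = (\<Union>n. {xs \<in> lists A. length xs = n})" by auto
  ultimately show ?thesis by (simp add: lepoll_def card_of_ordLeq)
qed

text \<open>Every real is determined by a term and a finite list of parameters. There are countably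
  many terms, so \<open>T\<close> is infinite, and then these pairs are no more numerous than
  \<open>T\<close>.\<close>

lemma spanning_eqpoll_reals:
  assumes T: "\<And>x. spans \<kappa> T x"
  shows "T \<approx> (UNIV :: real set)"
proof -
  \<comment> \<open>The added 0 fills list positions that are not variables of the term.\<close>
  let ?L = "(UNIV :: tm set) \<times> lists (insert 0 T)"
  let ?F = "\<lambda>(t, xs). Re (ev \<kappa> t (\<lambda>i. complex_of_real (xs ! i)))"
  have "x \<in> ?F ` ?L" for x
  proof -
    obtain t I c r \<tau> where a: "finite I" "hol I c r (ev \<kappa> t)" "\<tau> ` I \<subseteq> T" "ev \<kappa> t (cx \<tau>) = of_real x"
      using T[of x] unfolding spans_def by blast
    obtain N where N: "I \<subseteq> {..<N}" using a(1) finite_nat_bounded by auto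
    define xs where "xs = map (\<lambda>i. if i \<in> I then \<tau> i else 0) [0..<N]"
    have "ev \<kappa> t (\<lambda>i. complex_of_real (xs ! i)) = ev \<kappa> t (cx \<tau>)"
      by (rule depends_onD[of I]) (use a(2) N in \<open>auto simp: hol_def xs_def subset_iff\<close>)
    then have "?F (t, xs) = x" using a(4) by simp
    moreover have "(t, xs) \<in> ?L" using a(3) by (auto simp: xs_def image_subset_iff)
    ultimately show ?thesis by (metis image_eqI)
  qed
  then have "(UNIV :: real set) \<subseteq> ?F ` ?L" by blast
  then have le: "(UNIV :: real set) \<lesssim> ?L"
    by (meson image_lepoll lepoll_trans subset_imp_lepoll)
  have inf: "infinite T"
  proof
    assume "finite T"
    then have "countable ?L" by (intro countable_SIGMA countable_lists) (auto intro: countable_finite)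
    then show False using le countable_lepoll uncountable_UNIV_real by blast
  qed
  have "lists (insert 0 T) \<lesssim> insert 0 T"
    using inf by (intro lists_lepoll_infinite) simp
  then have "lists (insert 0 T) \<lesssim> T"
    by (rule lepoll_trans[OF _ infinite_insert_lepoll[OF inf]])
  moreover
  have "(UNIV :: tm set) \<lesssim> (UNIV :: nat set)"
    unfolding lepoll_def by (rule exI[of _ to_nat]) simp
  then have "(UNIV :: tm set) \<lesssim> T"
    by (rule lepoll_trans) (use inf infinite_le_lepoll in blast)
  ultimately have "?L \<lesssim> T" by (intro times_lepoll_infinite[OF inf])
  with le have "(UNIV :: real set) \<lesssim> T" by (rule lepoll_trans)
  moreover have "T \<lesssim> (UNIV :: real set)" by (rule subset_imp_lepoll) simp
  ultimately show ?thesis by (intro lepoll_antisym)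
qed

text \<open>Rational shifts preserve independence and span, so only the positions of the elements of
  a maximal independent set remain to be arranged. Continuum many elements in each interval later
  allow every coordinate of a chart to range over a copy of the real line.\<close>

lemma indep_spanning_dense:
  assumes rat: "\<And>q. of_rat q \<in> range \<kappa>"
  obtains T where "indep \<kappa> T" "\<And>x. spans \<kappa> T x" "\<And>a b. a < b \<Longrightarrow> T \<inter> {a<..<b} \<approx> (UNIV :: real set)"
proof -
  obtain one where one: "\<kappa> one = 1" using rat[of 1] by auto
  obtain S where S: "indep \<kappa> S" "\<And>x. x \<notin> S \<Longrightarrow> \<not> indep \<kappa> (insert x S)"
    using maximal_indep by blast
  have sp: "spans \<kappa> S x" for x by (rule maximal_indep_spans[OF one S])
  obtain h where h: "bij_betw h S (UNIV :: real set)"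
    using spanning_eqpoll_reals[OF sp] by (auto simp: eqpoll_def)
  \<comment> \<open>Elements of \<open>S\<close> are shifted into the rational interval coded by the integer part of their
    image under \<open>h\<close>, so each interval receives continuum many.\<close>
  define J :: "real \<Rightarrow> rat \<times> rat" where "J x = from_nat (nat \<lfloor>x\<rfloor>)" for x
  have "\<exists>q. fst (J (h t)) < snd (J (h t)) \<longrightarrow> t + of_rat q \<in> {of_rat (fst (J (h t)))<..<of_rat (snd (J (h t)))}" for t
  proof (cases "fst (J (h t)) < snd (J (h t))")
    case True
    then have "(of_rat (fst (J (h t))) - t) < (of_rat (snd (J (h t))) - t :: real)" by (simp add: of_rat_less)
    from of_rat_dense[OF this] show ?thesis by (auto simp: algebra_simps)
  qed simp
  then obtain q where q: "\<And>t. fst (J (h t)) < snd (J (h t)) \<Longrightarrow>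
      t + of_rat (q t) \<in> {of_rat (fst (J (h t)))<..<of_rat (snd (J (h t)))}" by metis
  define g where "g t = t + of_rat (q t)" for t
  have gq: "\<exists>p. g t = t + of_rat p" for t by (auto simp: g_def)
  have inj: "inj_on g S"
  proof (rule inj_onI, rule ccontr)
    fix s t assume a: "s \<in> S" "t \<in> S" "g s = g t" "s \<noteq> t"
    then have "s - t = of_rat (q t - q s)" by (simp add: g_def of_rat_diff algebra_simps)
    then show False using indep_diff_irrational[OF rat S(1) a(1,2,4)] by blast
  qed
  show ?thesis
  proof (rule that[of "g ` S"])
    show "indep \<kappa> (g ` S)" by (rule indep_shift[OF S(1) gq])
    show "spans \<kappa> (g ` S) x" for x by (rule spans_shift[OF sp gq inj])
    fix a b :: real assume ab: "a < b"
    obtain a' where a': "a < of_rat a'" "of_rat a' < b" using of_rat_dense[OF ab] by blast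
    obtain b' where b': "(of_rat a' :: real) < of_rat b'" "of_rat b' < b" using of_rat_dense[OF a'(2)] by blast
    define m where "m = to_nat (a', b')"
    \<comment> \<open>Images with integer part \<open>m\<close> code the interval from
      \<open>a'\<close> to \<open>b'\<close>; the open unit interval above \<open>m\<close> already
      contains continuum many of them.\<close>
    define K where "K = {t \<in> S. h t \<in> {real m<..<real m + 1}}"
    have gK: "g ` K \<subseteq> g ` S \<inter> {a<..<b}"
    proof safe
      fix t assume t: "t \<in> K"
      then have "\<lfloor>h t\<rfloor> = int m" by (simp add: K_def floor_eq_iff)
      then have "J (h t) = (a', b')" by (simp add: J_def m_def)
      moreover have "a' < b'" using b'(1) by (simp add: of_rat_less)
      ultimately have "g t \<in> {of_rat a'<..<of_rat b'}" using q[of t] by (simp add: g_def)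
      then show "g t \<in> {a<..<b}" using a' b' by simp
      show "g t \<in> g ` S" using t by (simp add: K_def)
    qed
    have "bij_betw h K {real m<..<real m + 1}"
      using h by (auto simp: bij_betw_def K_def inj_on_def image_iff) (metis UNIV_I image_iff)
    then have "{real m<..<real m + 1} \<approx> K" using eqpoll_def eqpoll_sym by blast
    moreover have "(UNIV :: real set) \<approx> {real m<..<real m + 1}"
      by (rule eqpoll_sym[OF iffD2[OF open_interval_eqpoll_reals]]) simp
    moreover have "K \<approx> g ` K"
      unfolding eqpoll_def by (rule exI[of _ g], rule bij_betw_imageI) (auto simp: K_def intro: inj_on_subset[OF inj])
    ultimately have "(UNIV :: real set) \<approx> g ` K" by (metis eqpoll_trans)
    from lepoll_trans[OF eqpoll_imp_lepoll[OF this] subset_imp_lepoll[OF gK]]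
    have "(UNIV :: real set) \<lesssim> g ` S \<inter> {a<..<b}" .
    moreover have "g ` S \<inter> {a<..<b} \<lesssim> (UNIV :: real set)" by (rule subset_imp_lepoll) simp
    ultimately show "g ` S \<inter> {a<..<b} \<approx> (UNIV :: real set)" by (intro lepoll_antisym)
  qed
qed

section \<open>Charts of real space by independent tuples\<close>

text \<open>Polynomials are functions of real arguments only, so agreement is demanded just at
  points where all the substituted terms take real values.\<close>

definition poly_term :: "(nat \<Rightarrow> real) \<Rightarrow> nat \<Rightarrow> ((nat \<Rightarrow> real) \<Rightarrow> real) \<Rightarrow> bool" where
  "poly_term \<kappa> N p \<longleftrightarrow> (\<forall>I c r F. (\<forall>v<N. hol I c r (ev \<kappa> (F v))) \<longrightarrow>
     (\<exists>t. hol I c r (ev \<kappa> t) \<and>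
       (\<forall>z x. (\<forall>v<N. ev \<kappa> (F v) z = of_real (x v)) \<longrightarrow> ev \<kappa> t z = of_real (p x))))"

lemma poly_term_const: 
  assumes "a \<in> range \<kappa>" shows "poly_term \<kappa> N (\<lambda>_. a)"
proof -
  obtain m where "a = \<kappa> m" using assms by blast
  then have "hol I c r (ev \<kappa> (Const m)) \<and> (\<forall>z. ev \<kappa> (Const m) z = of_real a)" for I c r
    by (simp add: hol_const)
  then show ?thesis unfolding poly_term_def by metis
qed

lemma poly_term_var: "i < N \<Longrightarrow> poly_term \<kappa> N (\<lambda>x. x i)"
  unfolding poly_term_def by blast

lemma poly_term_add:
  assumes "poly_term \<kappa> N p" "poly_term \<kappa> N q"
  shows "poly_term \<kappa> N (\<lambda>x. p x + q x)"
  unfolding poly_term_def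
proof (intro allI impI)
  fix I c r F assume F: "\<forall>v<N. hol I c r (ev \<kappa> (F v))"
  obtain s where s: "hol I c r (ev \<kappa> s)"
    "\<And>z x. (\<forall>v<N. ev \<kappa> (F v) z = of_real (x v)) \<Longrightarrow> ev \<kappa> s z = of_real (p x)"
    using assms(1) F unfolding poly_term_def by blast
  obtain t where t: "hol I c r (ev \<kappa> t)"
    "\<And>z x. (\<forall>v<N. ev \<kappa> (F v) z = of_real (x v)) \<Longrightarrow> ev \<kappa> t z = of_real (q x)"
    using assms(2) F unfolding poly_term_def by blast
  have "ev \<kappa> (Add s t) z = of_real (p x + q x)" if "\<forall>v<N. ev \<kappa> (F v) z = of_real (x v)" for z x
    using s(2)[OF that] t(2)[OF that] by simp
  moreover have "hol I c r (ev \<kappa> (Add s t))" using hol_add[OF s(1) t(1)] by simp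
  ultimately show "\<exists>t. hol I c r (ev \<kappa> t) \<and>
       (\<forall>z x. (\<forall>v<N. ev \<kappa> (F v) z = of_real (x v)) \<longrightarrow> ev \<kappa> t z = of_real (p x + q x))"
    by blast
qed

lemma poly_term_mult:
  assumes "poly_term \<kappa> N p" "poly_term \<kappa> N q"
  shows "poly_term \<kappa> N (\<lambda>x. p x * q x)"
  unfolding poly_term_def
proof (intro allI impI)
  fix I c r F assume F: "\<forall>v<N. hol I c r (ev \<kappa> (F v))"
  obtain s where s: "hol I c r (ev \<kappa> s)"
    "\<And>z x. (\<forall>v<N. ev \<kappa> (F v) z = of_real (x v)) \<Longrightarrow> ev \<kappa> s z = of_real (p x)"
    using assms(1) F unfolding poly_term_def by blast
  obtain t where t: "hol I c r (ev \<kappa> t)"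
    "\<And>z x. (\<forall>v<N. ev \<kappa> (F v) z = of_real (x v)) \<Longrightarrow> ev \<kappa> t z = of_real (q x)"
    using assms(2) F unfolding poly_term_def by blast
  have "ev \<kappa> (Mult s t) z = of_real (p x * q x)" if "\<forall>v<N. ev \<kappa> (F v) z = of_real (x v)" for z x
    using s(2)[OF that] t(2)[OF that] by simp
  moreover have "hol I c r (ev \<kappa> (Mult s t))" using hol_mult[OF s(1) t(1)] by simp
  ultimately show "\<exists>t. hol I c r (ev \<kappa> t) \<and>
       (\<forall>z x. (\<forall>v<N. ev \<kappa> (F v) z = of_real (x v)) \<longrightarrow> ev \<kappa> t z = of_real (p x * q x))"
    by blast
qed

text \<open>The finite set \<open>C\<close> collects the coefficients. It is found before \<kappa>,
  which can then be chosen to enumerate it together with the rationals.\<close>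

lemma poly_fun_poly_term:
  assumes "poly_fun N p"
  shows "\<exists>C. finite C \<and> (\<forall>\<kappa>. C \<subseteq> range \<kappa> \<longrightarrow> poly_term \<kappa> N p)"
  using assms
proof induction
  case (pf_const c)
  show ?case by (rule exI[of _ "{c}"]) (simp add: poly_term_const)
next
  case (pf_var i)
  then show ?case using poly_term_var by blast
next
  case (pf_add p q)
  then obtain C D where "finite C" "\<forall>\<kappa>. C \<subseteq> range \<kappa> \<longrightarrow> poly_term \<kappa> N p"
    "finite D" "\<forall>\<kappa>. D \<subseteq> range \<kappa> \<longrightarrow> poly_term \<kappa> N q" by blast
  then show ?case by (intro exI[of _ "C \<union> D"]) (simp add: poly_term_add)
next
  case (pf_mult p q)
  then obtain C D where "finite C" "\<forall>\<kappa>. C \<subseteq> range \<kappa> \<longrightarrow> poly_term \<kappa> N p"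
    "finite D" "\<forall>\<kappa>. D \<subseteq> range \<kappa> \<longrightarrow> poly_term \<kappa> N q" by blast
  then show ?case by (intro exI[of _ "C \<union> D"]) (simp add: poly_term_mult)
qed

text \<open>Taking real parts loses nothing on a chart, whose terms are real at the real points of
  its box.\<close>

definition eval_tuple :: "(nat \<Rightarrow> real) \<Rightarrow> tm list \<Rightarrow> real list \<Rightarrow> real list" where
  "eval_tuple \<kappa> fs u = map (\<lambda>t. Re (ev \<kappa> t (cx ((!) u)))) fs"

text \<open>Two instances matter: the points with coordinates in the independent set, and, with
  \<open>UNIV\<close>, the whole real box.\<close>

definition cells :: "real set \<Rightarrow> nat \<Rightarrow> (nat \<Rightarrow> real) \<Rightarrow> real \<Rightarrow> real list set" where
  "cells T d c \<rho> = {u. length u = d \<and> (\<forall>i<d. u ! i \<in> T \<inter> ball (c i) \<rho>)}"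

text \<open>Disjoint intervals prevent coincidences between entries at different positions, so only
  equalities \<open>a m ! i = a m' ! i\<close> at the same position remain to be recorded.\<close>

definition chart :: "(nat \<Rightarrow> real) \<Rightarrow> nat \<Rightarrow> tm list \<Rightarrow> (nat \<Rightarrow> real) \<Rightarrow> real \<Rightarrow> bool" where
  "chart \<kappa> d fs c \<rho> \<longleftrightarrow> 
     (\<forall>f\<in>set fs. hol {..<d} c (\<lambda>_. \<rho>) (ev \<kappa> f)) \<and>
     (\<forall>i<d. \<forall>j<d. i \<noteq> j \<longrightarrow> ball (c i) \<rho> \<inter> ball (c j) \<rho> = {}) \<and>
     (\<forall>f\<in>set fs. \<forall>\<sigma>\<in>rbox {..<d} c (\<lambda>_. \<rho>). ev \<kappa> f (cx \<sigma>) = of_real (Re (ev \<kappa> f (cx \<sigma>))))"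

text \<open>The value of \<open>p\<close> at the images of the \<open>a m\<close> is the value of
  one term with a variable for each distinct coordinate. By independence, this term vanishes for all
  real values of its variables in the box. The \<open>b m\<close> are such an assignment, as they
  repeat every coincidence of the \<open>a m\<close>.\<close>

lemma chart_transfer:
  assumes T: "indep \<kappa> T" and ch: "chart \<kappa> d fs c \<rho>" and n: "length fs = n"
    and p: "poly_term \<kappa> (k * n) p"
    and a: "\<And>m. m < k \<Longrightarrow> a m \<in> cells T d c \<rho>" and b: "\<And>m. m < k \<Longrightarrow> b m \<in> cells UNIV d c \<rho>"
    and pat: "\<And>m m' i. m < k \<Longrightarrow> m' < k \<Longrightarrow> i < d \<Longrightarrow> a m ! i = a m' ! i \<Longrightarrow> b m ! i = b m' ! i"
    and zero: "p (\<lambda>v. eval_tuple \<kappa> fs (a (v div n)) ! (v mod n)) = 0"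
  shows "p (\<lambda>v. eval_tuple \<kappa> fs (b (v div n)) ! (v mod n)) = 0"
proof -
  \<comment> \<open>Equal coordinates of the points must share a variable, since independence concerns distinct
    elements of \<open>T\<close> only: the variable of the \<open>i\<close>-th coordinate is named after the first point with
    the same \<open>i\<close>-th coordinate.\<close>
  define rep where "rep m i = (LEAST m'. m' < k \<and> a m' ! i = a m ! i)" for m i
  have rep: "rep m i < k" "a (rep m i) ! i = a m ! i" if "m < k" for m i
    using LeastI[of "\<lambda>m'. m' < k \<and> a m' ! i = a m ! i" m] that by (auto simp: rep_def)
  define V where "V m i = rep m i * d + i" for m i
  have Vdm: "V m i div d = rep m i" "V m i mod d = i" if "i < d" for m i
    using that by (auto simp: V_def)
  define I where "I = (\<lambda>(m, i). V m i) ` ({..<k} \<times> {..<d})"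
  define c' where "c' w = c (w mod d)" for w
  define \<tau> where "\<tau> w = a (w div d) ! (w mod d)" for w
  define \<sigma> where "\<sigma> w = b (w div d) ! (w mod d)" for w
  have \<tau>V: "\<tau> (V m i) = a m ! i" and \<sigma>V: "\<sigma> (V m i) = b m ! i" if "m < k" "i < d" for m i
    using that rep[OF that(1), of i] Vdm[of i m] pat[of "rep m i" m i] by (auto simp: \<tau>_def \<sigma>_def)
  have I: "finite I" by (simp add: I_def)
  have mem: "\<tau> \<in> rbox I c' (\<lambda>_. \<rho>)" "\<sigma> \<in> rbox I c' (\<lambda>_. \<rho>)" "\<tau> ` I \<subseteq> T"
    using a b \<tau>V \<sigma>V Vdm by (auto simp: rbox_def I_def c'_def cells_def)
  have inj: "inj_on \<tau> I"
  proof (rule inj_onI)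
    fix w w' assume "w \<in> I" "w' \<in> I" and eq: "\<tau> w = \<tau> w'"
    then obtain m i m' i' where w: "w = V m i" "m < k" "i < d" and w': "w' = V m' i'" "m' < k" "i' < d"
      by (auto simp: I_def)
    have e: "a m ! i = a m' ! i'" using eq w w' \<tau>V by simp
    have "a m ! i \<in> ball (c i) \<rho>" "a m' ! i' \<in> ball (c i') \<rho>"
      using a[OF w(2)] a[OF w'(2)] w w' by (auto simp: cells_def)
    \<comment> \<open>Entries at different positions lie in disjoint intervals, so equal values
      share a position and therefore a representative.\<close>
    then have "i = i'" using ch e w(3) w'(3) unfolding chart_def by (metis disjoint_iff)
    moreover then have "rep m i = rep m' i'" using e by (simp add: rep_def)
    ultimately show "w = w'" by (simp add: w w' V_def)
  qed
  \<comment> \<open>Variable \<open>v\<close> of \<open>p\<close> stands for coordinate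
    \<open>v mod n\<close> of the point \<open>v div n\<close>. For one fixed point distinct
    positions have distinct shared variables, as the renaming requires.\<close>
  have "\<exists>t. hol I c' (\<lambda>_. \<rho>) (ev \<kappa> t) \<and> (\<forall>z. ev \<kappa> t z = ev \<kappa> (fs ! (v mod n)) (\<lambda>i. z (V (v div n) i)))"
    if v: "v < k * n" for v
  proof -
    have n0: "0 < n" using v by (cases n) auto
    have h: "hol {..<d} c (\<lambda>_. \<rho>) (ev \<kappa> (fs ! (v mod n)))"
      using ch n n0 unfolding chart_def by simp
    have "v div n < k" using v by (simp add: less_mult_imp_div_less)
    then have im: "V (v div n) ` {..<d} \<subseteq> I" by (auto simp: I_def)
    have inj: "inj_on (V (v div n)) {..<d}" by (rule inj_onI) (metis Vdm(2) lessThan_iff)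
    have sub: "w + of_rat 0 \<in> ball (complex_of_real (c i)) \<rho>"
      if "i \<in> {..<d}" "w \<in> ball (complex_of_real (c' (V (v div n) i))) \<rho>" for i w
      using that Vdm(2)[of i] by (simp add: c'_def)
    obtain t where "hol I c' (\<lambda>_. \<rho>) (ev \<kappa> t)"
      "\<And>z. ev \<kappa> t z = ev \<kappa> (fs ! (v mod n)) (\<lambda>i. z (V (v div n) i) + of_rat 0)"
      using Ren_term[OF h finite_lessThan inj im, of c' "\<lambda>_. \<rho>" "\<lambda>_. 0", OF sub] by blast
    then show ?thesis by (intro exI[of _ t]) simp
  qed
  then obtain F where F: "\<And>v. v < k * n \<Longrightarrow> hol I c' (\<lambda>_. \<rho>) (ev \<kappa> (F v))"
    "\<And>v z. v < k * n \<Longrightarrow> ev \<kappa> (F v) z = ev \<kappa> (fs ! (v mod n)) (\<lambda>i. z (V (v div n) i))"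
    by metis
  then obtain t where t: "hol I c' (\<lambda>_. \<rho>) (ev \<kappa> t)"
    "\<And>z x. (\<forall>v<k*n. ev \<kappa> (F v) z = of_real (x v)) \<Longrightarrow> ev \<kappa> t z = of_real (p x)"
    using p unfolding poly_term_def by blast
  have val: "ev \<kappa> (F v) (cx \<theta>) = of_real (eval_tuple \<kappa> fs (e (v div n)) ! (v mod n))"
    if v: "v < k * n" and e: "\<And>m i. m < k \<Longrightarrow> i < d \<Longrightarrow> \<theta> (V m i) = e m ! i"
      and ec: "\<And>m. m < k \<Longrightarrow> e m \<in> cells UNIV d c \<rho>" for v \<theta> e
  proof -
    have n0: "0 < n" using v by (cases n) auto
    let ?f = "fs ! (v mod n)" and ?m = "v div n"
    have f: "?f \<in> set fs" using n n0 by simp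
    have m: "?m < k" using v by (simp add: less_mult_imp_div_less)
    have dep: "depends_on {..<d} (ev \<kappa> ?f)" using ch f unfolding chart_def hol_def by blast
    have "ev \<kappa> (F v) (cx \<theta>) = ev \<kappa> ?f (cx (\<lambda>i. \<theta> (V ?m i)))" by (simp add: F(2)[OF v])
    also have "\<dots> = ev \<kappa> ?f (cx ((!) (e ?m)))"
      by (rule depends_onD[OF dep]) (simp add: e m)
    also have "\<dots> = of_real (Re (ev \<kappa> ?f (cx ((!) (e ?m)))))"
    proof -
      have "(!) (e ?m) \<in> rbox {..<d} c (\<lambda>_. \<rho>)" using ec[OF m] by (auto simp: rbox_def cells_def)
      then show ?thesis using ch f unfolding chart_def by blast
    qed
    also have "Re (ev \<kappa> ?f (cx ((!) (e ?m)))) = eval_tuple \<kappa> fs (e ?m) ! (v mod n)"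
      using n n0 by (simp add: eval_tuple_def)
    finally show ?thesis .
  qed
  have "ev \<kappa> t (cx \<tau>) = of_real (p (\<lambda>v. eval_tuple \<kappa> fs (a (v div n)) ! (v mod n)))"
    by (rule t(2)) (use val[of _ \<tau> a] \<tau>V a in \<open>auto simp: cells_def\<close>)
  then have "ev \<kappa> t (cx \<tau>) = 0" using zero by simp
  then have "ev \<kappa> t (cx \<sigma>) = 0"
    by (rule indepD[OF T I t(1) inj mem(3,1,2)])
  moreover have "ev \<kappa> t (cx \<sigma>) = of_real (p (\<lambda>v. eval_tuple \<kappa> fs (b (v div n)) ! (v mod n)))"
    by (rule t(2)) (use val[of _ \<sigma> b] \<sigma>V b in \<open>auto simp: cells_def\<close>)
  ultimately show ?thesis by simp
qed

lemma spans_mono: "spans \<kappa> V x \<Longrightarrow> V \<subseteq> W \<Longrightarrow> spans \<kappa> W x"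
  unfolding spans_def by (meson order_trans)

lemma spans_finite:
  assumes "spans \<kappa> V x"
  obtains W where "finite W" "W \<subseteq> V" "spans \<kappa> W x"
proof -
  obtain t I c r \<tau> where a: "finite I" "hol I c r (ev \<kappa> t)" "inj_on \<tau> I" "\<tau> ` I \<subseteq> V"
    "\<tau> \<in> rbox I c r" "ev \<kappa> t (cx \<tau>) = of_real x"
    using assms unfolding spans_def by blast
  then have "spans \<kappa> (\<tau> ` I) x" unfolding spans_def by blast
  from that[OF _ a(4) this] a(1) show ?thesis by simp
qed

lemma minimal_spanning_list:
  assumes sp: "\<And>x. spans \<kappa> T x"
  shows "\<exists>ts. distinct ts \<and> set ts \<subseteq> T \<and> (\<forall>y\<in>set xs. spans \<kappa> (set ts) y) \<and>
    (\<forall>t\<in>set ts. \<not> (\<forall>y\<in>set xs. spans \<kappa> (set ts - {t}) y))"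
proof -
  define P where "P W \<longleftrightarrow> finite W \<and> W \<subseteq> T \<and> (\<forall>y\<in>set xs. spans \<kappa> W y)" for W
  have "\<exists>W. finite W \<and> W \<subseteq> T \<and> spans \<kappa> W y" for y by (rule spans_finite[OF sp[of y]]) blast
  then obtain W where W: "\<And>y. finite (W y) \<and> W y \<subseteq> T \<and> spans \<kappa> (W y) y" by metis
  have "P (\<Union>y\<in>set xs. W y)"
    unfolding P_def
  proof (intro conjI ballI)
    show "spans \<kappa> (\<Union>y\<in>set xs. W y) y" if "y \<in> set xs" for y
      by (rule spans_mono[of \<kappa> "W y"]) (use W that in blast)+
  qed (use W in blast)+
  then obtain U where U: "P U" "\<And>W. P W \<Longrightarrow> card U \<le> card W"
    using ex_has_least_nat[of P _ card] by blast
  obtain ts where ts: "set ts = U" "distinct ts" using U(1) finite_distinct_list unfolding P_def by blast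
  have "\<not> P (U - {t})" if "t \<in> U" for t
  proof
    assume "P (U - {t})"
    then have "card U \<le> card (U - {t})" by (rule U(2))
    moreover have "card (U - {t}) < card U" using that U(1) by (intro card_Diff1_less) (auto simp: P_def)
    ultimately show False by simp
  qed
  then show ?thesis using U(1) ts unfolding P_def by (intro exI[of _ ts]) auto
qed

text \<open>Normal form of a spanning witness: variable \<open>i\<close> stands for the
  \<open>i\<close>-th parameter, and the polydisc is centred at the parameters with one common
  radius.\<close>

lemma spans_list_term:
  assumes x: "spans \<kappa> (set ts) x" and ts: "distinct ts"
  shows "\<exists>\<delta>>0. \<exists>t. hol {..<length ts} ((!) ts) (\<lambda>_. \<delta>) (ev \<kappa> t) \<and> ev \<kappa> t (cx ((!) ts)) = of_real x"
proof -
  obtain t I c r \<tau> where a: "finite I" "hol I c r (ev \<kappa> t)" "inj_on \<tau> I" "\<tau> ` I \<subseteq> set ts"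
    "\<tau> \<in> rbox I c r" "ev \<kappa> t (cx \<tau>) = of_real x"
    using x unfolding spans_def by blast
  have "\<exists>l. i \<in> I \<longrightarrow> l < length ts \<and> ts ! l = \<tau> i" for i
    using a(4) by (metis image_subset_iff in_set_conv_nth)
  then obtain l where l: "\<And>i. i \<in> I \<Longrightarrow> l i < length ts" "\<And>i. i \<in> I \<Longrightarrow> ts ! l i = \<tau> i" by metis
  \<comment> \<open>The least distance from a parameter to the edge of its original disc; the 1
    covers empty \<open>I\<close>.\<close>
  define \<delta> where "\<delta> = Min (insert 1 ((\<lambda>i. r i - dist (c i) (\<tau> i)) ` I))"
  have \<delta>: "\<delta> > 0" "\<And>i. i \<in> I \<Longrightarrow> \<delta> \<le> r i - dist (c i) (\<tau> i)"
    using a(1,5) by (auto simp: \<delta>_def rbox_def)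
  have inj: "inj_on l I" using a(3) l(2) by (metis inj_on_def)
  have sub: "w + of_rat 0 \<in> ball (complex_of_real (c i)) (r i)"
    if "i \<in> I" "w \<in> ball (complex_of_real (ts ! l i)) \<delta>" for i w
  proof -
    have "dist (complex_of_real (c i)) (complex_of_real (\<tau> i)) = dist (c i) (\<tau> i)"
      by (simp add: dist_norm flip: of_real_diff)
    then show ?thesis
      using that l(2)[OF that(1)] \<delta>(2)[OF that(1)]
        dist_triangle[of "complex_of_real (c i)" w "complex_of_real (\<tau> i)"] by simp
  qed
  have im: "l ` I \<subseteq> {..<length ts}" using l(1) by auto
  obtain t' where t': "hol {..<length ts} ((!) ts) (\<lambda>_. \<delta>) (ev \<kappa> t')"
    "\<And>z. ev \<kappa> t' z = ev \<kappa> t (\<lambda>i. z (l i) + of_rat 0)"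
    using Ren_term[OF a(2,1) inj im, of "(!) ts" "\<lambda>_. \<delta>" "\<lambda>_. 0", OF sub] by blast
  have "ev \<kappa> t' (cx ((!) ts)) = ev \<kappa> t (cx \<tau>)"
    unfolding t'(2) by (rule depends_onD[of I]) (use a(2) l in \<open>auto simp: hol_def\<close>)
  then show ?thesis using a(6) t'(1) \<delta>(1) by metis
qed

lemma real_valued_on_box:
  assumes m1: "\<kappa> m1 = - 1" and T: "indep \<kappa> T" and I: "finite I"
    and f: "hol I c r (ev \<kappa> f)" and \<tau>: "inj_on \<tau> I" "\<tau> ` I \<subseteq> T" "\<tau> \<in> rbox I c r" and x: "ev \<kappa> f (cx \<tau>) = of_real x"
    and \<sigma>: "\<sigma> \<in> rbox I c r"
  shows "ev \<kappa> f (cx \<sigma>) = of_real (Re (ev \<kappa> f (cx \<sigma>)))"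
proof -
  \<comment> \<open>The difference of \<open>f\<close> and its conjugate vanishes at \<open>\<tau>\<close>, hence at all real points.\<close>
  let ?t = "Add f (Mult (Const m1) (Star f))"
  have "hol I c r (ev \<kappa> ?t)"
    unfolding ev.simps by (intro hol_add hol_mult hol_const hol_cnj f)
  moreover have "ev \<kappa> ?t (cx \<tau>) = 0" by (simp add: m1 x)
  ultimately have "ev \<kappa> ?t (cx \<sigma>) = 0" using indepD[OF T I _ \<tau> \<sigma>] by blast
  then have "cnj (ev \<kappa> f (cx \<sigma>)) = ev \<kappa> f (cx \<sigma>)" by (simp add: m1)
  then show ?thesis by (metis Reals_cnj_iff of_real_Re)
qed

text \<open>An irredundant list of parameters spanning the entries of \<open>xs\<close> is itself
  the point of the cell that is mapped to \<open>xs\<close>. Rational centres and radii leave only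
  countably many charts.\<close>

lemma chart_exists:
  assumes rat: "\<And>q. of_rat q \<in> range \<kappa>" and T: "indep \<kappa> T" and sp: "\<And>x. spans \<kappa> T x"
  shows "\<exists>fs cs \<rho>. let d = length cs; c = (\<lambda>i. of_rat (cs ! i)) in
    length fs = length xs \<and> 0 < \<rho> \<and> chart \<kappa> d fs c (of_rat \<rho>) \<and>
    inj_on (eval_tuple \<kappa> fs) (cells T d c (of_rat \<rho>)) \<and>
    xs \<in> eval_tuple \<kappa> fs ` cells T d c (of_rat \<rho>)"
proof -
  obtain m1 where m1: "\<kappa> m1 = - 1" using rat[of "-1"] by (auto simp: of_rat_minus)
  obtain ts where ts: "distinct ts" "set ts \<subseteq> T" "\<And>y. y \<in> set xs \<Longrightarrow> spans \<kappa> (set ts) y"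
    and min: "\<And>t. t \<in> set ts \<Longrightarrow> \<exists>y\<in>set xs. \<not> spans \<kappa> (set ts - {t}) y"
    using minimal_spanning_list[OF sp, of xs] by blast
  let ?d = "length ts" and ?n = "length xs"
  have "\<exists>\<delta> t. j < ?n \<longrightarrow> \<delta> > 0 \<and> hol {..<?d} ((!) ts) (\<lambda>_. \<delta>) (ev \<kappa> t) \<and> ev \<kappa> t (cx ((!) ts)) = of_real (xs ! j)" for j
    using spans_list_term[OF ts(3) ts(1)] nth_mem[of j xs] by blast
  then obtain \<delta> F where F: "\<And>j. j < ?n \<Longrightarrow> \<delta> j > 0" "\<And>j. j < ?n \<Longrightarrow> hol {..<?d} ((!) ts) (\<lambda>_. \<delta> j) (ev \<kappa> (F j))"
    "\<And>j. j < ?n \<Longrightarrow> ev \<kappa> (F j) (cx ((!) ts)) = of_real (xs ! j)" by metis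
  \<comment> \<open>All bounds that the discs must respect: the radii on which the terms are
    holomorphic and the gaps between distinct parameters.\<close>
  define S where "S = insert 1 (\<delta> ` {..<?n} \<union> (\<lambda>(s, t). \<bar>s - t\<bar>) ` {p \<in> set ts \<times> set ts. fst p \<noteq> snd p})"
  have S: "finite S" "\<And>s. s \<in> S \<Longrightarrow> s > 0" using F(1) by (auto simp: S_def)
  define \<epsilon> where "\<epsilon> = Min S"
  have S0: "S \<noteq> {}" by (simp add: S_def)
  have \<epsilon>: "\<epsilon> > 0" "\<And>s. s \<in> S \<Longrightarrow> \<epsilon> \<le> s"
    using S(2)[OF Min_in[OF S(1) S0]] Min_le[OF S(1)] by (simp_all add: \<epsilon>_def)
  have \<epsilon>\<delta>: "\<epsilon> \<le> \<delta> j" if "j < ?n" for j by (rule \<epsilon>(2)) (use that in \<open>auto simp: S_def\<close>)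
  have \<epsilon>ts: "\<epsilon> \<le> \<bar>s - t\<bar>" if "s \<in> set ts" "t \<in> set ts" "s \<noteq> t" for s t
    by (rule \<epsilon>(2)) (use that in \<open>force simp: S_def\<close>)
  \<comment> \<open>A point in the discs of two parameters would put these within four radii of each
    other, hence the factor 4. Each disc also stays within two radii of its parameter.\<close>
  obtain \<rho> where \<rho>: "0 < (of_rat \<rho> :: real)" "of_rat \<rho> < \<epsilon> / 4"
    using of_rat_dense[of 0 "\<epsilon> / 4"] \<epsilon>(1) by auto
  let ?\<rho> = "of_rat \<rho> :: real"
  have "\<exists>q. \<bar>of_rat q - t\<bar> < ?\<rho>" for t
    using of_rat_dense[of t "t + ?\<rho>"] \<rho>(1) by (metis abs_of_pos add.commute diff_gt_0_iff_gt diff_less_eq less_add_same_cancel1)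
  then obtain q where q: "\<And>t. \<bar>of_rat (q t) - t\<bar> < ?\<rho>" by metis
  define cs where "cs = map q ts"
  define c :: "nat \<Rightarrow> real" where "c i = of_rat (cs ! i)" for i
  define fs where "fs = map F [0..<?n]"
  have c: "\<bar>c i - ts ! i\<bar> < ?\<rho>" if "i < ?d" for i using that q by (simp add: c_def cs_def)
  have hfs: "hol {..<?d} c (\<lambda>_. ?\<rho>) (ev \<kappa> (F j))" if j: "j < ?n" for j
  proof (rule hol_mono[OF F(2)[OF j] subset_refl])
    fix i assume i: "i \<in> {..<?d}"
    show "ball (complex_of_real (c i)) ?\<rho> \<subseteq> ball (complex_of_real (ts ! i)) (\<delta> j)"
    proof
      fix w assume "w \<in> ball (complex_of_real (c i)) ?\<rho>"
      moreover have "dist (complex_of_real (ts ! i)) (complex_of_real (c i)) < ?\<rho>"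
        using c[of i] i by (simp add: dist_norm abs_minus_commute flip: of_real_diff)
      ultimately show "w \<in> ball (complex_of_real (ts ! i)) (\<delta> j)"
        using dist_triangle[of "complex_of_real (ts ! i)" w "complex_of_real (c i)"] \<rho> \<epsilon>(1) \<epsilon>\<delta>[OF j] by simp
    qed
  qed
  have disj: "ball (c i) ?\<rho> \<inter> ball (c j) ?\<rho> = {}" if "i < ?d" "j < ?d" "i \<noteq> j" for i j
  proof (rule ccontr)
    assume "\<not> ?thesis"
    then obtain w where "\<bar>c i - w\<bar> < ?\<rho>" "\<bar>c j - w\<bar> < ?\<rho>" by (auto simp: dist_real_def)
    then have "\<bar>ts ! i - ts ! j\<bar> < \<epsilon>" using c[OF that(1)] c[OF that(2)] \<rho>(2) by linarith
    moreover have "ts ! i \<noteq> ts ! j" using ts(1) that by (simp add: nth_eq_iff_index_eq)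
    ultimately show False using \<epsilon>ts[of "ts ! i" "ts ! j"] that by simp
  qed
  have tsbox: "(!) ts \<in> rbox {..<?d} c (\<lambda>_. ?\<rho>)" using c by (auto simp: rbox_def dist_real_def)
  have tsinj: "inj_on ((!) ts) {..<?d}" using ts(1) by (simp add: inj_on_nth)
  have tsT: "(!) ts ` {..<?d} \<subseteq> T" using ts(2) by auto
  have re: "ev \<kappa> (F j) (cx \<sigma>) = of_real (Re (ev \<kappa> (F j) (cx \<sigma>)))"
    if "j < ?n" "\<sigma> \<in> rbox {..<?d} c (\<lambda>_. ?\<rho>)" for j \<sigma>
    by (rule real_valued_on_box[OF m1 T _ hfs[OF that(1)] tsinj tsT tsbox F(3)[OF that(1)] that(2)]) simp
  have chart: "chart \<kappa> ?d fs c ?\<rho>"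
    unfolding chart_def using hfs disj re by (auto simp: fs_def)
  have val: "eval_tuple \<kappa> fs ts = xs"
    by (rule nth_equalityI) (simp_all add: eval_tuple_def fs_def F(3))
  have ts_cell: "ts \<in> cells T ?d c ?\<rho>" using tsT tsbox by (auto simp: cells_def rbox_def)
  have inj: "inj_on (eval_tuple \<kappa> fs) (cells T ?d c ?\<rho>)"
  proof (rule inj_onI, rule ccontr)
    fix u v assume u: "u \<in> cells T ?d c ?\<rho>" and v: "v \<in> cells T ?d c ?\<rho>"
      and eq: "eval_tuple \<kappa> fs u = eval_tuple \<kappa> fs v" and "u \<noteq> v"
    moreover have "length u = ?d" "length v = ?d" using u v by (auto simp: cells_def)
    ultimately obtain i where i: "i < ?d" "u ! i \<noteq> v ! i" using nth_equalityI[of u v] by metis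
    \<comment> \<open>Transferring the coincidence of the values at \<open>u\<close> and \<open>v\<close> shows that the \<open>i\<close>-th entry of \<open>ts\<close> can be
      replaced by a rational, against the minimality of \<open>ts\<close>.\<close>
    let ?a = "\<lambda>m::nat. if m = 0 then u else v" and ?b = "\<lambda>m::nat. if m = 0 then ts else ts[i := c i]"
    have "spans \<kappa> (set ts - {ts ! i}) (xs ! j)" if j: "j < ?n" for j
    proof -
      \<comment> \<open>A relation between two points of dimension \<open>?n\<close>: their
        \<open>j\<close>-th coordinates agree.\<close>
      let ?p = "\<lambda>x. x j + (-1) * x (?n + j) :: real"
      have p: "poly_term \<kappa> (2 * ?n) ?p"
        using rat[of "-1"] j by (intro poly_term_add poly_term_mult poly_term_const poly_term_var) (auto simp: of_rat_minus)
      have "?p (\<lambda>v. eval_tuple \<kappa> fs (?b (v div ?n)) ! (v mod ?n)) = 0"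
      proof (rule chart_transfer[OF T chart _ p])
        show "length fs = ?n" by (simp add: fs_def)
        show "?a m \<in> cells T ?d c ?\<rho>" for m using u v by simp
        have "ts[i := c i] \<in> cells UNIV ?d c ?\<rho>"
          using ts_cell \<rho>(1) i(1) by (auto simp: cells_def nth_list_update)
        then show "?b m \<in> cells UNIV ?d c ?\<rho>" for m using ts_cell by (auto simp: cells_def)
        \<comment> \<open>The two target points differ only at position \<open>i\<close>, where
          \<open>u\<close> and \<open>v\<close> differ as well.\<close>
        show "?b m ! i' = ?b m' ! i'" if "i' < ?d" "?a m ! i' = ?a m' ! i'" for m m' i'
          using that i by (cases "i' = i") (auto split: if_splits)
        show "?p (\<lambda>v. eval_tuple \<kappa> fs (?a (v div ?n)) ! (v mod ?n)) = 0"
          using j eq by simp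
      qed
      moreover have "j div ?n = 0" "j mod ?n = j" "(?n + j) mod ?n = j" using j by simp_all
      moreover have "(?n + j) div ?n = 1" by (rule div_nat_eqI) (use j in auto)
      ultimately have "eval_tuple \<kappa> fs ts ! j + - 1 * eval_tuple \<kappa> fs (ts[i := c i]) ! j = 0"
        by (simp only: simp_thms if_True if_False one_neq_zero)
      then have "eval_tuple \<kappa> fs ts ! j = eval_tuple \<kappa> fs (ts[i := c i]) ! j" by simp
      then have "xs ! j = Re (ev \<kappa> (F j) (cx ((!) (ts[i := c i]))))"
        using j unfolding val by (simp add: eval_tuple_def fs_def)
      moreover have "(!) (ts[i := c i]) \<in> rbox {..<?d} c (\<lambda>_. ?\<rho>)"
        using tsbox \<rho>(1) i(1) by (auto simp: rbox_def nth_list_update)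
      ultimately have x: "of_real (xs ! j) = ev \<kappa> (F j) (cx ((!) (ts[i := c i])))"
        using re[OF j] by simp
      also have "\<dots> = ev \<kappa> (F j) ((cx ((!) ts))(i := of_rat (cs ! i)))"
        by (rule depends_onD[of "{..<?d}"])
          (use hfs[OF j] i in \<open>auto simp: hol_def nth_list_update c_def complex_of_real_of_rat\<close>)
      finally have "ev \<kappa> (Sub i (cs ! i) (F j)) (cx ((!) ts)) = of_real (xs ! j)" by simp
      moreover have "hol ({..<?d} - {i}) c (\<lambda>_. ?\<rho>) (ev \<kappa> (Sub i (cs ! i) (F j)))"
        using hol_subst[OF hfs[OF j], of "of_rat (cs ! i)" i] \<rho>(1) by (simp add: c_def complex_of_real_of_rat)
      moreover have "inj_on ((!) ts) ({..<?d} - {i})" using tsinj by (rule inj_on_subset) auto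
      moreover have "(!) ts ` ({..<?d} - {i}) \<subseteq> set ts - {ts ! i}"
        using ts(1) i by (auto simp: nth_eq_iff_index_eq)
      moreover have "(!) ts \<in> rbox ({..<?d} - {i}) c (\<lambda>_. ?\<rho>)" using tsbox by (auto simp: rbox_def)
      moreover have "finite ({..<?d} - {i})" by simp
      ultimately show ?thesis unfolding spans_def by blast
    qed
    then have "\<forall>y\<in>set xs. spans \<kappa> (set ts - {ts ! i}) y" by (metis in_set_conv_nth)
    then show False using min[of "ts ! i"] i by simp
  qed
  have "length cs = ?d" by (simp add: cs_def)
  moreover have "length fs = ?n" by (simp add: fs_def)
  moreover have "0 < \<rho>" using \<rho>(1) by simp
  moreover have "(\<lambda>i. of_rat (cs ! i)) = c" by (simp add: c_def fun_eq_iff)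
  ultimately show ?thesis
    using chart inj val ts_cell unfolding Let_def
    by (intro exI[of _ fs] exI[of _ cs] exI[of _ \<rho>]) (auto intro: rev_image_eqI)
qed

section \<open>Polynomial functions: congruence and finite sums and products\<close>

lemma poly_fun_cong: "poly_fun N p \<Longrightarrow> (\<And>v. v < N \<Longrightarrow> x v = y v) \<Longrightarrow> p x = p y"
  by (induction rule: poly_fun.induct) auto

lemma poly_fun_sum:
  assumes "finite S" "\<And>s. s \<in> S \<Longrightarrow> poly_fun N (f s)"
  shows "poly_fun N (\<lambda>x. \<Sum>s\<in>S. f s x)"
  using assms by (induction S rule: finite_induct) (auto intro: pf_const pf_add)

lemma poly_fun_prod:
  assumes "finite S" "\<And>s. s \<in> S \<Longrightarrow> poly_fun N (f s)"
  shows "poly_fun N (\<lambda>x. \<Prod>s\<in>S. f s x)"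
  using assms by (induction S rule: finite_induct) (auto intro: pf_const pf_mult)

lemma poly_fun_diff_square:
  assumes "u < N" "v < N"
  shows "poly_fun N (\<lambda>x. (x u - x v)\<^sup>2)"
proof -
  have "poly_fun N (\<lambda>x. x u + (-1) * x v)"
    by (intro pf_add pf_mult pf_const pf_var assms)
  from pf_mult[OF this this] show ?thesis by (simp add: power2_eq_square)
qed

section \<open>Template hypergraphs\<close>

text \<open>For enumerated \<open>k\<close>-sets, matching the enumerations is a homomorphism
  exactly when the coincidence pattern of the source is contained in that of the target. So a closed
  family is given by its finitely many patterns. Containing a pattern means that a sum of squares
  vanishes, and containing one of several means that the product vanishes.\<close>

lemma hom_closed_algebraic_edges:
  assumes PP: "PP \<subseteq> ksubsets k (Rn d)"
    and closed: "\<And>P Q. P \<in> PP \<Longrightarrow> Q \<in> ksubsets k (Rn d) \<Longrightarrow> hom_image d P Q \<Longrightarrow> Q \<in> PP"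
  shows "\<exists>p. poly_fun (k * d) p \<and> algebraic_edges k d p = PP"
proof -
  define Ix where "Ix = {..<d} \<times> {..<k} \<times> {..<k}"
  define pat :: "(nat \<Rightarrow> real list) \<Rightarrow> (nat \<times> nat \<times> nat) set" where
    "pat a = {(i, m, m') \<in> Ix. a m ! i = a m' ! i}" for a
  define Pats where "Pats = pat ` {a. \<exists>P\<in>PP. bij_betw a {..<k} P}"
  have Ix: "finite Ix" by (simp add: Ix_def)
  have pat: "pat a \<subseteq> Ix" for a by (auto simp: pat_def)
  have Pats: "finite Pats" by (rule finite_subset[of _ "Pow Ix"]) (use pat Ix in \<open>auto simp: Pats_def\<close>)
  have PatsIx: "\<pi> \<subseteq> Ix" "finite \<pi>" if "\<pi> \<in> Pats" for \<pi>
    using that pat Ix finite_subset unfolding Pats_def by blast+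
  define sq :: "nat \<times> nat \<times> nat \<Rightarrow> (nat \<Rightarrow> real) \<Rightarrow> real" where
    "sq = (\<lambda>(i, m, m') x. (x (m * d + i) - x (m' * d + i))\<^sup>2)"
  \<comment> \<open>For empty \<open>PP\<close> this is the empty product 1, which gives no
    edges.\<close>
  define p where "p x = (\<Prod>\<pi>\<in>Pats. \<Sum>s\<in>\<pi>. sq s x)" for x
  have less: "m * d + i < k * d" if "m < k" "i < d" for m i
  proof -
    have "m * d + i < Suc m * d" using that by simp
    also have "\<dots> \<le> k * d" using that by (intro mult_le_mono1) simp
    finally show ?thesis .
  qed
  have "poly_fun (k * d) (sq s)" if "s \<in> Ix" for s
    using that by (auto simp: Ix_def sq_def intro!: poly_fun_diff_square less)
  then have "poly_fun (k * d) (sq s)" if "\<pi> \<in> Pats" "s \<in> \<pi>" for s \<pi>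
    using PatsIx(1)[OF that(1)] that(2) by blast
  then have poly: "poly_fun (k * d) p"
    unfolding p_def using Pats PatsIx(2) by (intro poly_fun_prod poly_fun_sum)
  have sq0: "sq s (\<lambda>v. a (v div d) ! (v mod d)) = 0 \<longleftrightarrow> s \<in> pat a" if "s \<in> Ix" for s a
    using that by (auto simp: sq_def Ix_def pat_def)
  have p0: "p (\<lambda>v. a (v div d) ! (v mod d)) = 0 \<longleftrightarrow> (\<exists>\<pi>\<in>Pats. \<pi> \<subseteq> pat a)" for a
  proof -
    have "(\<Sum>s\<in>\<pi>. sq s (\<lambda>v. a (v div d) ! (v mod d))) = 0 \<longleftrightarrow> \<pi> \<subseteq> pat a" if "\<pi> \<in> Pats" for \<pi>
    proof -
      have "sq s x \<ge> 0" for s x by (cases s) (simp add: sq_def)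
      then have "(\<Sum>s\<in>\<pi>. sq s (\<lambda>v. a (v div d) ! (v mod d))) = 0 \<longleftrightarrow> (\<forall>s\<in>\<pi>. sq s (\<lambda>v. a (v div d) ! (v mod d)) = 0)"
        using PatsIx[OF that] by (intro sum_nonneg_eq_0_iff) auto
      also have "\<dots> \<longleftrightarrow> \<pi> \<subseteq> pat a" using sq0 PatsIx(1)[OF that] by blast
      finally show ?thesis .
    qed
    then show ?thesis using Pats by (simp add: p_def)
  qed
  have "e \<in> algebraic_edges k d p \<longleftrightarrow> e \<in> PP" for e
  proof
    assume "e \<in> algebraic_edges k d p"
    then obtain a where e: "e \<in> ksubsets k (Rn d)" and a: "bij_betw a {..<k} e"
      and "p (\<lambda>v. a (v div d) ! (v mod d)) = 0" by (auto simp: algebraic_edges_def)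
    then obtain b P where b: "P \<in> PP" "bij_betw b {..<k} P" "pat b \<subseteq> pat a"
      unfolding p0 Pats_def by blast
    \<comment> \<open>The index of an element of \<open>P\<close> in the enumeration
      \<open>b\<close>; following it by \<open>a\<close> gives the homomorphism.\<close>
    define g where "g = inv_into {..<k} b"
    have g: "bij_betw g P {..<k}" unfolding g_def using b(2) by (rule bij_betw_inv_into)
    have bg: "b (g x) = x" if "x \<in> P" for x
      unfolding g_def using b(2) that by (simp add: bij_betw_inv_into_right)
    have "template_hom d P e (a \<circ> g)"
      unfolding template_hom_def
    proof (intro conjI ballI allI impI)
      have "bij_betw (a \<circ> g) P e" using g a by (rule bij_betw_trans)
      then show "(a \<circ> g) ` P \<subseteq> e" "inj_on (a \<circ> g) P" by (auto simp: bij_betw_def)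
      fix x y i assume xy: "x \<in> P" "y \<in> P" "i < d" "x ! i = y ! i"
      then have "(i, g x, g y) \<in> pat b" using g bg by (auto simp: pat_def Ix_def dest: bij_betwE)
      then have "(i, g x, g y) \<in> pat a" using b(3) by blast
      then show "(a \<circ> g) x ! i = (a \<circ> g) y ! i" by (simp add: pat_def)
    qed
    then show "e \<in> PP" using closed[OF b(1) e] by (auto simp: hom_image_def)
  next
    assume e: "e \<in> PP"
    then have ek: "e \<in> ksubsets k (Rn d)" using PP by blast
    then obtain a where a: "bij_betw a {..<k} e"
      by (metis (mono_tags, lifting) ex_bij_betw_nat_finite ksubsets_def lessThan_atLeast0 mem_Collect_eq)
    then have "pat a \<in> Pats" using e by (auto simp: Pats_def)
    then have "p (\<lambda>v. a (v div d) ! (v mod d)) = 0" unfolding p0 by blast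
    then show "e \<in> algebraic_edges k d p" using ek a by (auto simp: algebraic_edges_def)
  qed
  with poly show ?thesis by blast
qed

text \<open>Each interval contains continuum many elements of \<open>T\<close>, so coordinatewise
  bijections identify the space \<open>Rn d\<close> with the cell. They preserve and reflect
  equality of coordinates, hence coincidence patterns. By \<open>chart_transfer\<close> the edges
  pulled back along the chart are closed under homomorphisms, so they form a template hypergraph and
  are algebraic.\<close>

lemma chart_image_iso:
  assumes k: "2 \<le> k" and T: "indep \<kappa> T" "\<And>a b. a < b \<Longrightarrow> T \<inter> {a<..<b} \<approx> (UNIV :: real set)"
    and ch: "chart \<kappa> d fs c \<rho>" "length fs = n" "0 < \<rho>" and inj: "inj_on (eval_tuple \<kappa> fs) (cells T d c \<rho>)"
    and p: "poly_fun (k * n) p" "poly_term \<kappa> (k * n) p" and A: "A = eval_tuple \<kappa> fs ` cells T d c \<rho>"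
  shows "\<exists>PP. (\<forall>P\<in>PP. template d k P) \<and> algebraic_hg k (multi_template d k (Rn d) PP) \<and>
    hg_iso (induced k (Rn n, algebraic_edges k n p) A) (multi_template d k (Rn d) PP)"
proof -
  let ?E = "algebraic_edges k n p"
  have "\<exists>\<beta>. bij_betw \<beta> (UNIV :: real set) (T \<inter> ball (c i) \<rho>)" for i
  proof -
    have "ball (c i) \<rho> = {c i - \<rho><..<c i + \<rho>}" by (auto simp: dist_real_def)
    then have "T \<inter> ball (c i) \<rho> \<approx> (UNIV :: real set)" using T(2)[of "c i - \<rho>" "c i + \<rho>"] ch(3) by simp
    then show ?thesis using eqpoll_sym unfolding eqpoll_def by blast
  qed
  then obtain \<beta> where \<beta>: "\<And>i. bij_betw (\<beta> i) (UNIV :: real set) (T \<inter> ball (c i) \<rho>)" by metis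
  have \<beta>inj: "\<beta> i s = \<beta> i t \<longleftrightarrow> s = t" for i s t
    using \<beta>[of i] by (auto simp: bij_betw_def inj_on_def)
  define B where "B u = map (\<lambda>i. \<beta> i (u ! i)) [0..<d]" for u
  have Bnth: "B u ! i = \<beta> i (u ! i)" if "i < d" for u i using that by (simp add: B_def)
  have Bcell: "B u \<in> cells T d c \<rho>" for u
  proof -
    have "\<beta> i s \<in> T \<inter> ball (c i) \<rho>" for i s using bij_betwE[OF \<beta>] by blast
    then show ?thesis unfolding cells_def by (simp add: Bnth del: mem_ball) (simp add: B_def)
  qed
  have B: "bij_betw B (Rn d) (cells T d c \<rho>)"
  proof (rule bij_betwI')
    fix u v assume uv: "u \<in> Rn d" "v \<in> Rn d"
    have "u = v" if "B u = B v"
    proof (rule nth_equalityI)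
      show "length u = length v" using uv by (simp add: Rn_def)
      fix i assume "i < length u"
      then have "i < d" using uv by (simp add: Rn_def)
      then show "u ! i = v ! i" using arg_cong[OF that, of "\<lambda>w. w ! i"] by (simp add: Bnth \<beta>inj)
    qed
    then show "(B u = B v) = (u = v)" by blast
  next
    fix w assume w: "w \<in> cells T d c \<rho>"
    have "\<exists>s. i < d \<longrightarrow> \<beta> i s = w ! i" for i
      using \<beta>[of i] w unfolding bij_betw_def cells_def by (metis (no_types, lifting) imageE mem_Collect_eq)
    then obtain s where s: "\<And>i. i < d \<Longrightarrow> \<beta> i (s i) = w ! i" by metis
    have "w = B (map s [0..<d])"
      by (rule nth_equalityI) (use w s in \<open>auto simp: cells_def B_def\<close>)
    then show "\<exists>u\<in>Rn d. w = B u" by (intro bexI[of _ "map s [0..<d]"]) (auto simp: Rn_def)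
  qed (rule Bcell)
  define \<Phi> where "\<Phi> = eval_tuple \<kappa> fs \<circ> B"
  have \<Phi>: "bij_betw \<Phi> (Rn d) A"
    unfolding \<Phi>_def A by (rule bij_betw_trans[OF B]) (rule inj_on_imp_bij_betw[OF inj])
  have \<Phi>inj: "inj_on \<Phi> (Rn d)" and \<Phi>im: "\<Phi> ` Rn d = A" using \<Phi> by (auto simp: bij_betw_def)
  have \<Phi>len: "\<Phi> u \<in> Rn n" for u by (simp add: \<Phi>_def eval_tuple_def Rn_def ch(2))
  have ARn: "A \<subseteq> Rn n" using \<Phi>len \<Phi>im by blast
  \<comment> \<open>The pulled-back edges serve as the set of templates too.\<close>
  define PP where "PP = {Q \<in> ksubsets k (Rn d). \<Phi> ` Q \<in> ?E}"
  have closed: "Q \<in> PP" if P: "P \<in> PP" and Q: "Q \<in> ksubsets k (Rn d)" and "hom_image d P Q" for P Q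
  proof -
    obtain f where f: "f ` P \<subseteq> Q" "inj_on f P"
      "\<And>x y i. x \<in> P \<Longrightarrow> y \<in> P \<Longrightarrow> i < d \<Longrightarrow> x ! i = y ! i \<Longrightarrow> f x ! i = f y ! i"
      using \<open>hom_image d P Q\<close> unfolding hom_image_def template_hom_def by blast
    have Pk: "P \<subseteq> Rn d" "finite P" "card P = k" and Qk: "Q \<subseteq> Rn d" "finite Q" "card Q = k"
      using P Q by (auto simp: PP_def ksubsets_def)
    have fP: "f ` P = Q" using f Pk Qk by (intro card_subset_eq) (auto simp: card_image)
    obtain a where a: "bij_betw a {..<k} (\<Phi> ` P)" "p (\<lambda>v. a (v div n) ! (v mod n)) = 0"
      using P by (auto simp: PP_def algebraic_edges_def)
    define x where "x m = inv_into P \<Phi> (a m)" for m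
    have \<Phi>P: "bij_betw \<Phi> P (\<Phi> ` P)"
      using \<Phi>inj Pk(1) by (meson inj_on_imp_bij_betw inj_on_subset)
    have x: "bij_betw x {..<k} P"
      using bij_betw_trans[OF a(1) bij_betw_inv_into[OF \<Phi>P]] by (simp add: x_def[abs_def] o_def)
    have xP: "x m \<in> P" if "m < k" for m using x that by (auto dest: bij_betwE)
    have ax: "a m = eval_tuple \<kappa> fs (B (x m))" if "m < k" for m
      using a(1) that f_inv_into_f[of "a m" \<Phi> P] by (auto simp: x_def \<Phi>_def dest: bij_betwE)
    define b where "b m = B (f (x m))" for m
    have coord: "v div n < k" if "v < k * n" for v using that by (simp add: less_mult_imp_div_less)
    \<comment> \<open>The enumeration \<open>a\<close> is known only at indices below
      \<open>k\<close>, which are the only ones that \<open>p\<close> reads.\<close>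
    have "p (\<lambda>v. eval_tuple \<kappa> fs (B (x (v div n))) ! (v mod n)) = p (\<lambda>v. a (v div n) ! (v mod n))"
      by (rule poly_fun_cong[OF p(1)]) (simp add: ax coord)
    then have zero: "p (\<lambda>v. eval_tuple \<kappa> fs (B (x (v div n))) ! (v mod n)) = 0" using a(2) by simp
    have "p (\<lambda>v. eval_tuple \<kappa> fs (b (v div n)) ! (v mod n)) = 0"
    proof (rule chart_transfer[OF T(1) ch(1,2) p(2) _ _ _ zero])
      show "B (x m) \<in> cells T d c \<rho>" for m by (rule Bcell)
      show "b m \<in> cells UNIV d c \<rho>" for m using Bcell[of "f (x m)"] by (simp add: b_def cells_def)
      show "b m ! i = b m' ! i" if "m < k" "m' < k" "i < d" "B (x m) ! i = B (x m') ! i" for m m' i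
        using that f(3)[OF xP[OF that(1)] xP[OF that(2)] that(3)] by (simp add: b_def Bnth \<beta>inj)
    qed
    then have "p (\<lambda>v. \<Phi> (f (x (v div n))) ! (v mod n)) = 0" by (simp add: b_def \<Phi>_def)
    moreover have "bij_betw (\<lambda>m. \<Phi> (f (x m))) {..<k} (\<Phi> ` Q)"
    proof -
      have "bij_betw f P Q" using f(2) fP by (simp add: bij_betw_def)
      moreover have "bij_betw \<Phi> Q (\<Phi> ` Q)"
        using \<Phi>inj Qk(1) by (meson inj_on_imp_bij_betw inj_on_subset)
      ultimately show ?thesis using bij_betw_trans[OF x] bij_betw_trans by (fastforce simp: o_def)
    qed
    moreover have "\<Phi> ` Q \<in> ksubsets k (Rn n)"
      using Qk \<Phi>len card_image[OF inj_on_subset[OF \<Phi>inj Qk(1)]] by (auto simp: ksubsets_def)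
    ultimately have "\<Phi> ` Q \<in> ?E" unfolding algebraic_edges_def by blast
    then show ?thesis using Q by (simp add: PP_def)
  qed
  have PPk: "PP \<subseteq> ksubsets k (Rn d)" by (auto simp: PP_def)
  have refl: "hom_image d P P" for P
    unfolding hom_image_def template_hom_def by (rule exI[of _ "\<lambda>x. x"]) simp
  \<comment> \<open>The identity makes each template an edge, and closure under homomorphisms adds
    no further edges.\<close>
  have mt: "multi_template d k (Rn d) PP = (Rn d, PP)"
    unfolding multi_template_def using closed PPk refl by blast
  have "\<exists>q. poly_fun (k * d) q \<and> algebraic_edges k d q = PP"
    by (rule hom_closed_algebraic_edges[OF PPk closed])
  then have "algebraic_hg k (Rn d, PP)" using k by (auto simp: algebraic_hg_def)
  moreover have "\<forall>P\<in>PP. template d k P" using PPk by (auto simp: template_def ksubsets_def)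
  moreover have "hg_iso (induced k (Rn n, ?E) A) (Rn d, PP)"
    unfolding hg_iso_def
  proof (intro exI[of _ "inv_into (Rn d) \<Phi>"] conjI allI impI)
    show "bij_betw (inv_into (Rn d) \<Phi>) (fst (induced k (Rn n, ?E) A)) (fst (Rn d, PP))"
      using bij_betw_inv_into[OF \<Phi>] by (simp add: induced_def)
    fix e assume "e \<subseteq> fst (induced k (Rn n, ?E) A)"
    then have e: "e \<subseteq> A" by (simp add: induced_def)
    let ?Q = "inv_into (Rn d) \<Phi> ` e"
    have Q: "\<Phi> ` ?Q = e" using e \<Phi>im by (simp add: image_inv_into_cancel)
    have QR: "?Q \<subseteq> Rn d" using e \<Phi>im by (auto intro: inv_into_into)
    have inje: "inj_on (inv_into (Rn d) \<Phi>) e"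
      using e \<Phi>im by (intro inj_on_inv_into) simp
    have "?Q \<in> ksubsets k (Rn d) \<longleftrightarrow> e \<in> ksubsets k A"
      using QR e card_image[OF inje] finite_image_iff[OF inje] by (simp add: ksubsets_def)
    moreover have "?E \<subseteq> ksubsets k (Rn n)" by (auto simp: algebraic_edges_def)
    ultimately show "(e \<in> snd (induced k (Rn n, ?E) A)) = (?Q \<in> snd (Rn d, PP))"
      using Q by (auto simp: induced_def PP_def)
  qed
  ultimately show ?thesis using mt by (intro exI[of _ PP]) simp
qed

section \<open>The countable cover\<close>

theorem theorem1p1:
  fixes k n :: nat and E :: "real list set set"
  assumes "k_hypergraph k (Rn n, E)"
    and "algebraic_hg k (Rn n, E)"
  shows "\<exists>\<A> :: real list set set. countable \<A> \<and> \<Union>\<A> = Rn n \<and>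
           (\<forall>A\<in>\<A>. \<exists>d PP. (\<forall>P\<in>PP. template d k P) \<and>
               algebraic_hg k (multi_template d k (Rn d) PP) \<and>
               hg_iso (induced k (Rn n, E) A) (multi_template d k (Rn d) PP))"
proof -
  obtain n' p where k: "2 \<le> k" and p': "poly_fun (k * n') p" and "Rn n = Rn n'" "E = algebraic_edges k n' p"
    using assms(2) by (auto simp: algebraic_hg_def)
  moreover have "n = n'"
  proof -
    have "replicate n (0::real) \<in> Rn n'" unfolding \<open>Rn n = Rn n'\<close>[symmetric] by (simp add: Rn_def)
    then show ?thesis by (simp add: Rn_def)
  qed
  ultimately have p: "poly_fun (k * n) p" and E: "E = algebraic_edges k n p" by simp_all
  obtain C where C: "finite C" "\<And>\<kappa>. C \<subseteq> range \<kappa> \<Longrightarrow> poly_term \<kappa> (k * n) p"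
    using poly_fun_poly_term[OF p] by blast
  \<comment> \<open>The admissible constants: the coefficients of \<open>p\<close> and all
    rationals, a countable nonempty set that \<kappa> enumerates.\<close>
  define K :: "real set" where "K = C \<union> range of_rat"
  have "countable K" "K \<noteq> {}" using C(1) by (auto simp: K_def intro: countable_finite)
  then have \<kappa>: "range (from_nat_into K) = K" by (simp add: range_from_nat_into)
  define \<kappa> where "\<kappa> = from_nat_into K"
  have rat: "of_rat q \<in> range \<kappa>" for q using \<kappa> by (simp add: \<kappa>_def K_def)
  have pt: "poly_term \<kappa> (k * n) p" by (rule C(2)) (use \<kappa> in \<open>simp add: \<kappa>_def K_def\<close>)
  obtain T where T: "indep \<kappa> T" "\<And>x. spans \<kappa> T x" "\<And>a b. a < b \<Longrightarrow> T \<inter> {a<..<b} \<approx> (UNIV :: real set)"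
    using indep_spanning_dense[OF rat] by blast
  \<comment> \<open>Charts are indexed by lists of terms, lists of rationals and a rational, a
    countable type; hence the cover is countable.\<close>
  define good where "good = (\<lambda>(fs, cs, \<rho>). let d = length cs; c = (\<lambda>i. of_rat (cs ! i)) in
    length fs = n \<and> 0 < \<rho> \<and> chart \<kappa> d fs c (of_rat \<rho>) \<and>
    inj_on (eval_tuple \<kappa> fs) (cells T d c (of_rat \<rho>)))"
  define piece where "piece = (\<lambda>(fs, cs, \<rho>). eval_tuple \<kappa> fs ` cells T (length cs) (\<lambda>i. of_rat (cs ! i)) (of_rat \<rho>))"
  let ?\<A> = "piece ` {x :: tm list \<times> rat list \<times> rat. good x}"
  show ?thesis
  proof (intro exI[of _ ?\<A>] conjI ballI)
    show "countable ?\<A>" by (intro countable_image countableI_type)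
    show "\<Union> ?\<A> = Rn n"
    proof
      show "\<Union> ?\<A> \<subseteq> Rn n" by (auto simp: piece_def good_def Let_def eval_tuple_def Rn_def)
      show "Rn n \<subseteq> \<Union> ?\<A>"
      proof
        fix x :: "real list" assume "x \<in> Rn n"
        then have "\<exists>y. good y \<and> x \<in> piece y"
          using chart_exists[OF rat T(1,2), of x] by (fastforce simp: Rn_def good_def piece_def Let_def)
        then show "x \<in> \<Union> ?\<A>" by blast
      qed
    qed
    fix A assume "A \<in> ?\<A>"
    then obtain fs cs \<rho> where g: "good (fs, cs, \<rho>)" and A: "A = piece (fs, cs, \<rho>)" by auto
    have "\<exists>PP. (\<forall>P\<in>PP. template (length cs) k P) \<and> algebraic_hg k (multi_template (length cs) k (Rn (length cs)) PP) \<and>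
      hg_iso (induced k (Rn n, algebraic_edges k n p) A) (multi_template (length cs) k (Rn (length cs)) PP)"
      by (rule chart_image_iso[OF k T(1,3), where c = "\<lambda>i. of_rat (cs ! i)" and \<rho> = "of_rat \<rho>" and fs = fs])
        (use g p pt in \<open>auto simp: good_def Let_def A piece_def\<close>)
    then show "\<exists>d PP. (\<forall>P\<in>PP. template d k P) \<and> algebraic_hg k (multi_template d k (Rn d) PP) \<and>
        hg_iso (induced k (Rn n, E) A) (multi_template d k (Rn d) PP)"
      unfolding E by blast
  qed
qed

end
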